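(* Let $R>1$. If the constant $A$ satisfies $A>(\log R)^2$, then there exists a unique function $\psi\in C^2(0,1)\cap Q^{1,2}$ satisfying, for some constant $\lambda>0$, the conditions (i) $\psi$ is a critical point of the functional $J+\lambda G$ over the space of variations $W^{1,2}_0(0,1)$, and (ii) $G(\psi)=0$, and the following properties. (iii) The function $\psi$ is strictly increasing and solves the initial value problem $$\psi'=\frac{1}{\sqrt{\lambda}}\,\psi\sqrt{\mu+(\psi^2-1)^2+(\psi-1)^2},\qquad\psi(0)=1,$$ where the pair of positive constants $\lambda$ and $\mu$ is the unique solution of the system of equations $$\int_1^R\frac{ds}{s\sqrt{\mu+(s^2-1)^2+(s-1)^2}}=\frac{1}{\sqrt{\lambda}},\qquad \frac{1}{\sqrt{\lambda}}\int_1^R\frac{\sqrt{\mu+(s^2-1)^2+(s-1)^2}}{s}\,ds=A.$$ (iv) The function $\psi$ is the unique solution of the optimization problem: minimize $J(\psi)$ for $\psi\in Q_+$ subject to $G(\psi)\le0$.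
   Context: $A>0$ is a constant and $$J(\psi)=\int_0^1(\psi^2-1)^2dt+\int_0^1(\psi-1)^2dt,\qquad G(\psi)=\int_0^1\Big(\frac{\psi'}{\psi}\Big)^2dt-A .$$ $Q^{1,2}=\{\phi\in W^{1,2}(0,1):\phi(0)=1,\ \phi(1)=R\}$ (boundary values in the classical sense, since such $\phi$ are absolutely continuous on $[0,1]$); $Q_+=\{\phi\in C^2(0,1)\cap C[0,1]:\phi(0)=1,\ \phi(1)=R,\ \phi\text{ is (strictly) increasing}\}$. "Critical point over the space of variations $W_0^{1,2}(0,1)$" means that the Gateaux derivative of the functional at $\psi$ vanishes in every direction $h\in W^{1,2}_0(0,1)$. *)

theory Defs
  imports "HOL-Analysis.Analysis"
begin

text \<open>
  A function on \<open>[0,1]\<close> is represented by a total function on the reals; its values outside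
  \<open>[0,1]\<close> carry no meaning, so functions are compared on \<open>{0..1}\<close> only.
\<close>

definition C2_on :: "real set \<Rightarrow> (real \<Rightarrow> real) set" where
  "C2_on S = {f. f C1_differentiable_on S \<and> deriv f C1_differentiable_on S}"

text \<open>
  Sobolev spaces on \<open>(0,1)\<close> in the textbook one-dimensional form: the test functions are
  \<open>C\<^sub>c\<^sup>1(0,1)\<close>, and the weak derivative is only required to be locally integrable.
  Elements of \<open>W\<^sup>1\<^sup>,\<^sup>2\<close> and \<open>W\<^sub>0\<^sup>1\<^sup>,\<^sup>2\<close> are arbitrary Borel representatives.
\<close>

definition test_fun :: "(real \<Rightarrow> real) set" where
  "test_fun = {\<eta>. \<eta> C1_differentiable_on UNIV \<and>
     (\<exists>K. compact K \<and> K \<subseteq> {0<..<1} \<and> (\<forall>t. t \<notin> K \<longrightarrow> \<eta> t = 0))}"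

definition loc_integrable :: "(real \<Rightarrow> real) \<Rightarrow> bool" where
  "loc_integrable f \<longleftrightarrow> (\<forall>K. compact K \<and> K \<subseteq> {0<..<1} \<longrightarrow> set_integrable lborel K f)"

definition has_weak_derivative :: "(real \<Rightarrow> real) \<Rightarrow> (real \<Rightarrow> real) \<Rightarrow> bool" where
  "has_weak_derivative f g \<longleftrightarrow> loc_integrable f \<and> loc_integrable g \<and>
     (\<forall>\<eta>\<in>test_fun. (LBINT t:{0<..<1}. f t * deriv \<eta> t) = - (LBINT t:{0<..<1}. g t * \<eta> t))"

text \<open>Determined up to equality almost everywhere on \<open>(0,1)\<close>, if it exists.\<close>

definition weak_deriv :: "(real \<Rightarrow> real) \<Rightarrow> real \<Rightarrow> real" where
  "weak_deriv f = (SOME g. has_weak_derivative f g)"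

definition L2 :: "(real \<Rightarrow> real) set" where
  "L2 = {f. set_borel_measurable lborel {0<..<1} f \<and>
            set_integrable lborel {0<..<1} (\<lambda>t. (f t)\<^sup>2)}"

definition W12 :: "(real \<Rightarrow> real) set" where
  "W12 = {f \<in> L2. \<exists>g\<in>L2. has_weak_derivative f g}"

definition W12_norm :: "(real \<Rightarrow> real) \<Rightarrow> real" where
  "W12_norm f = sqrt ((LBINT t:{0<..<1}. (f t)\<^sup>2) + (LBINT t:{0<..<1}. (weak_deriv f t)\<^sup>2))"

text \<open>The closure of the test functions in \<open>W\<^sup>1\<^sup>,\<^sup>2(0,1)\<close>.\<close>

definition W012 :: "(real \<Rightarrow> real) set" where
  "W012 = {h \<in> W12. \<exists>\<eta>. (\<forall>n::nat. \<eta> n \<in> test_fun) \<and>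
             (\<lambda>n. W12_norm (\<lambda>t. \<eta> n t - h t)) \<longlonglongrightarrow> 0}"

text \<open>Boundary values are those of the continuous representative on \<open>[0,1]\<close>.\<close>

definition Q12 :: "real \<Rightarrow> (real \<Rightarrow> real) set" where
  "Q12 R = {\<phi> \<in> W12. continuous_on {0..1} \<phi> \<and> \<phi> 0 = 1 \<and> \<phi> 1 = R}"

definition Q_plus :: "real \<Rightarrow> (real \<Rightarrow> real) set" where
  "Q_plus R = {\<phi> \<in> C2_on {0<..<1}. continuous_on {0..1} \<phi> \<and> \<phi> 0 = 1 \<and> \<phi> 1 = R \<and>
                 strict_mono_on {0..1} \<phi>}"

definition J :: "(real \<Rightarrow> real) \<Rightarrow> real" where
  "J \<phi> = (LBINT t:{0<..<1}. ((\<phi> t)\<^sup>2 - 1)\<^sup>2) + (LBINT t:{0<..<1}. (\<phi> t - 1)\<^sup>2)"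

text \<open>
  \<open>G\<close> is extended-real valued: it is \<open>\<infinity>\<close> when \<open>\<phi>'/\<phi>\<close> is not square integrable, which does occur
  on \<open>Q_plus\<close>, whereas the Bochner integral would return 0 there. The value 0 of a
  division by 0 plays no role: if the continuous representative of \<open>\<phi>\<close> is nonzero at 0 and
  vanishes somewhere, then \<open>\<phi>'/\<phi>\<close> is not square integrable up to its first zero.
\<close>

definition G :: "real \<Rightarrow> (real \<Rightarrow> real) \<Rightarrow> ereal" where
  "G A \<phi> = enn2ereal (\<integral>\<^sup>+t\<in>{0<..<1}. ennreal ((weak_deriv \<phi> t / \<phi> t)\<^sup>2) \<partial>lborel) - ereal A"

definition has_gateaux_derivative ::
    "((real \<Rightarrow> real) \<Rightarrow> ereal) \<Rightarrow> (real \<Rightarrow> real) \<Rightarrow> (real \<Rightarrow> real) \<Rightarrow> real \<Rightarrow> bool" where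
  "has_gateaux_derivative F \<psi> h D \<longleftrightarrow>
     (\<forall>\<^sub>F \<epsilon> in nhds 0. \<bar>F (\<lambda>t. \<psi> t + \<epsilon> * h t)\<bar> \<noteq> \<infinity>) \<and>
     ((\<lambda>\<epsilon>. real_of_ereal (F (\<lambda>t. \<psi> t + \<epsilon> * h t))) has_real_derivative D) (at 0)"

definition critical_point ::
    "((real \<Rightarrow> real) \<Rightarrow> ereal) \<Rightarrow> (real \<Rightarrow> real) set \<Rightarrow> (real \<Rightarrow> real) \<Rightarrow> bool" where
  "critical_point F H \<psi> \<longleftrightarrow> (\<forall>h\<in>H. has_gateaux_derivative F \<psi> h 0)"

definition multiplier_system :: "real \<Rightarrow> real \<Rightarrow> real \<Rightarrow> real \<Rightarrow> bool" where
  "multiplier_system R A l m \<longleftrightarrow>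
     (LBINT s:{1..R}. 1 / (s * sqrt (m + (s\<^sup>2 - 1)\<^sup>2 + (s - 1)\<^sup>2))) = 1 / sqrt l \<and>
     1 / sqrt l * (LBINT s:{1..R}. sqrt (m + (s\<^sup>2 - 1)\<^sup>2 + (s - 1)\<^sup>2) / s) = A"

end

theory Submission
  imports Defs
begin

text \<open>
  Put \<open>u = ln \<phi>\<close> and \<open>f s = (s\<^sup>2 - 1)\<^sup>2 + (s - 1)\<^sup>2\<close>, so that \<open>J\<close> and \<open>G\<close> become
  \<open>\<integral> f (exp u)\<close> and \<open>\<integral> u'\<^sup>2 - A\<close>. A critical point of \<open>J + \<lambda> G\<close> solves
  \<open>2 \<lambda> u'' = (f \<circ> exp)' (u)\<close>, hence conserves \<open>\<mu> = \<lambda> u'\<^sup>2 - f (exp u)\<close>. Letting \<open>t \<rightarrow> 0\<close> gives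
  \<open>\<mu> \<ge> 0\<close>, and \<open>\<mu> = 0\<close> would force \<open>\<phi> = 1\<close> by a Gronwall argument; so \<open>u'\<close> has no zero and
  \<open>\<phi>\<close> solves the first-order equation of (iii).

  Conversely, along a solution of that equation with \<open>G \<phi> = 0\<close> the functional \<open>J + \<lambda> G\<close> is convex
  in \<open>u \<ge> 0\<close>, strictly so in its first term, and therefore \<open>\<phi>\<close> is the unique minimizer in (iv).
  All uniqueness claims reduce to this one: two solutions of the multiplier system produce two
  minimizers, which coincide, and comparing their slopes at \<open>t = 0\<close> and \<open>t = 1\<close> identifies the
  multipliers. The product of the two integrals in the multiplier system is continuous in \<open>\<mu>\<close>,
  unbounded as \<open>\<mu> \<rightarrow> 0\<close> and tends to \<open>(ln R)\<^sup>2\<close> as \<open>\<mu> \<rightarrow> \<infinity>\<close>, which gives existence.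
\<close>


section \<open>Integration on the unit interval\<close>

text \<open>Three obstacles shape the proof. First, \<open>pot \<circ> exp\<close> is not convex on
  the whole line; convexity is used only for function values \<ge> 1. A critical point is not known
  to stay there, and two critical points need not share the multiplier \<lambda>. So critical points
  are never compared directly: each is first shown to solve the first-order equation, which makes it
  increasing, hence \<ge> 1 and a member of \<open>Q_plus R\<close>. Two such functions with
  \<open>G = 0\<close> are then compared through the constrained problem, in which no multiplier
  occurs. Second, members of \<open>Q_plus R\<close> and critical points may have derivatives that
  are unbounded near 0 and 1. Integration by parts therefore rests on a fundamental theorem with
  interior derivatives and an integrable right-hand side; integrability comes from the finiteness of
  \<open>G\<close>. Third, elements of \<open>W012\<close> are arbitrary Borel representatives,
  whereas the quotient in \<open>G\<close> calls for \<phi> + \<epsilon> h bounded away from 0. An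
  essential bound on h is extracted from its approximating test functions.\<close>

definition lborel01 :: "real measure" where
  "lborel01 = restrict_space lborel {0<..<1}"

lemma space_lborel01 [simp]: "space lborel01 = {0<..<1}"
  by (simp add: lborel01_def space_restrict_space)

text \<open>Finiteness is what makes constants, bounded functions and members of \<open>L2\<close>
  integrable.\<close>

lemma finite_measure_lborel01: "finite_measure lborel01"
  by (rule finite_measureI) (simp add: lborel01_def emeasure_restrict_space space_restrict_space)

interpretation lborel01: finite_measure lborel01
  by (rule finite_measure_lborel01)

lemma measure_lborel01 [simp]: "measure lborel01 {0<..<1} = 1"
  by (simp add: lborel01_def measure_restrict_space)

lemma LBINT01: "(LBINT t:{0<..<1}. f t) = integral\<^sup>L lborel01 (f::real\<Rightarrow>real)"
  by (simp add: lborel01_def integral_restrict_space set_lebesgue_integral_def)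

lemma set_integrable01: "set_integrable lborel {0<..<1} f \<longleftrightarrow> integrable lborel01 (f::real\<Rightarrow>real)"
  by (simp add: lborel01_def integrable_restrict_space set_integrable_def)

lemma set_borel_measurable01:
  "set_borel_measurable lborel {0<..<1} f \<longleftrightarrow> (f::real\<Rightarrow>real) \<in> borel_measurable lborel01"
  by (simp add: lborel01_def borel_measurable_restrict_space_iff set_borel_measurable_def)

lemma nn_integral01: "(\<integral>\<^sup>+t\<in>{0<..<1}. f t \<partial>lborel) = integral\<^sup>N lborel01 f"
  by (simp add: lborel01_def nn_integral_restrict_space)

lemma AE01: "(AE t in lborel01. P t) \<longleftrightarrow> (AE t in lborel. t \<in> {0<..<1} \<longrightarrow> P t)"
  unfolding lborel01_def by (rule AE_restrict_space_iff) simp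

lemma L2_iff: "f \<in> L2 \<longleftrightarrow> f \<in> borel_measurable lborel01 \<and> integrable lborel01 (\<lambda>t. (f t)\<^sup>2)"
  by (simp add: L2_def set_borel_measurable01 set_integrable01)

lemma L2D:
  assumes "f \<in> L2"
  shows "f \<in> borel_measurable lborel01"
    and "integrable lborel01 (\<lambda>t. (f t)\<^sup>2)"
  using assms by (auto simp: L2_iff)

lemma L2_bound:
  assumes f: "f \<in> borel_measurable lborel01" and g: "integrable lborel01 g"
    and "AE t in lborel01. (f t)\<^sup>2 \<le> g t"
  shows "f \<in> L2"
  unfolding L2_iff
proof
  show "integrable lborel01 (\<lambda>t. (f t)\<^sup>2)"
    using f by (intro Bochner_Integration.integrable_bound[OF g]) (use assms(3) in auto)
qed fact

lemma L2_mult: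
  assumes f: "f \<in> L2" and g: "g \<in> L2"
  shows "integrable lborel01 (\<lambda>t. f t * g t)"
proof -
  note [measurable] = L2D(1)[OF f] L2D(1)[OF g]
  have "integrable lborel01 (\<lambda>t. (f t)\<^sup>2 + (g t)\<^sup>2)"
    using L2D(2) f g by auto
  then show ?thesis
  proof (rule Bochner_Integration.integrable_bound)
    have "\<bar>x * y\<bar> \<le> \<bar>x\<^sup>2 + y\<^sup>2\<bar>" for x y :: real
    proof -
      have "2 * \<bar>x\<bar> * \<bar>y\<bar> \<le> x\<^sup>2 + y\<^sup>2" using sum_squares_bound[of "\<bar>x\<bar>" "\<bar>y\<bar>"] by simp
      moreover have "0 \<le> \<bar>x\<bar> * \<bar>y\<bar>" by simp
      ultimately show ?thesis unfolding abs_mult by linarith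
    qed
    then show "AE t in lborel01. norm (f t * g t) \<le> norm ((f t)\<^sup>2 + (g t)\<^sup>2)" by simp
  qed measurable
qed

lemma L2_const [simp]: "(\<lambda>_. c) \<in> L2"
  by (simp add: L2_iff)

lemma L2_integrable: "f \<in> L2 \<Longrightarrow> integrable lborel01 f"
  using L2_mult[of f "\<lambda>_. 1"] by simp

lemma L2_add:
  assumes f: "f \<in> L2" and g: "g \<in> L2"
  shows "(\<lambda>t. f t + g t) \<in> L2"
proof (rule L2_bound)
  show "integrable lborel01 (\<lambda>t. 2 * (f t)\<^sup>2 + 2 * (g t)\<^sup>2)"
    using L2D(2) f g by auto
  have "(x + y)\<^sup>2 \<le> 2 * x\<^sup>2 + 2 * y\<^sup>2" for x y :: real
    using sum_squares_bound[of x y] by (simp add: power2_sum)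
  then show "AE t in lborel01. (f t + g t)\<^sup>2 \<le> 2 * (f t)\<^sup>2 + 2 * (g t)\<^sup>2" by auto
qed (use L2D(1) f g in measurable)

lemma L2_mult_bounded:
  assumes f: "f \<in> L2" and g [measurable]: "g \<in> borel_measurable lborel01"
    and B: "AE t in lborel01. \<bar>g t\<bar> \<le> B"
  shows "(\<lambda>t. g t * f t) \<in> L2"
proof (rule L2_bound)
  note [measurable] = L2D(1)[OF f]
  show "(\<lambda>t. g t * f t) \<in> borel_measurable lborel01" by measurable
  show "integrable lborel01 (\<lambda>t. B\<^sup>2 * (f t)\<^sup>2)" using L2D(2)[OF f] by auto
  show "AE t in lborel01. (g t * f t)\<^sup>2 \<le> B\<^sup>2 * (f t)\<^sup>2"
    using B
  proof eventually_elim
    case (elim t)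
    then have "\<bar>g t\<bar>\<^sup>2 \<le> B\<^sup>2" by (intro power_mono) auto
    then show ?case by (simp add: power_mult_distrib mult_right_mono)
  qed
qed

lemma L2_cmult: "f \<in> L2 \<Longrightarrow> (\<lambda>t. c * f t) \<in> L2"
  by (rule L2_mult_bounded[where B="\<bar>c\<bar>"]) auto

lemma L2_diff: "f \<in> L2 \<Longrightarrow> g \<in> L2 \<Longrightarrow> (\<lambda>t. f t - g t) \<in> L2"
  using L2_add[of f "\<lambda>t. (-1) * g t"] L2_cmult[of g "-1"] by simp

lemma L2_bounded:
  assumes "f \<in> borel_measurable lborel01" "AE t in lborel01. \<bar>f t\<bar> \<le> B"
  shows "f \<in> L2"
  using L2_mult_bounded[of "\<lambda>_. 1" f B] assms by simp

lemma measurable01_continuous: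
  fixes f :: "real \<Rightarrow> real"
  assumes "continuous_on {0<..<1} f"
  shows "f \<in> borel_measurable lborel01"
  using borel_measurable_continuous_on_restrict[OF assms]
  by (simp add: lborel01_def cong: measurable_cong_sets sets_restrict_space_cong)

lemma bounded01_continuous:
  fixes f :: "real \<Rightarrow> real"
  assumes "continuous_on {0..1} f"
  obtains B where "B > 0" "\<And>t. t \<in> {0..1} \<Longrightarrow> \<bar>f t\<bar> \<le> B"
proof -
  have "compact (f ` {0..1})" by (rule compact_continuous_image[OF assms]) simp
  then obtain B where "B > 0" "\<forall>x\<in>f ` {0..1}. norm x \<le> B"
    using compact_imp_bounded bounded_pos by blast
  with that show ?thesis by auto
qed

lemma AE01I: "(\<And>t. t \<in> {0<..<1} \<Longrightarrow> P t) \<Longrightarrow> AE t in lborel01. P t"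
  by (rule AE_I2) simp

lemma L2_continuous:
  fixes f :: "real \<Rightarrow> real"
  assumes "continuous_on {0..1} f"
  shows "f \<in> L2"
proof -
  obtain B where "\<And>t. t \<in> {0..1} \<Longrightarrow> \<bar>f t\<bar> \<le> B" using bounded01_continuous[OF assms] by metis
  then show ?thesis
    by (intro L2_bounded[where B=B] AE01I measurable01_continuous continuous_on_subset[OF assms]) auto
qed

text \<open>The variance of \<open>f\<close> is nonnegative; the constant term contributes
  \<open>?m^2\<close> because the total mass is 1.\<close>

lemma integral01_square_le:
  assumes f: "f \<in> L2"
  shows "(\<integral>t. f t \<partial>lborel01)\<^sup>2 \<le> (\<integral>t. (f t)\<^sup>2 \<partial>lborel01)"
proof -
  let ?m = "\<integral>t. f t \<partial>lborel01"
  have "0 \<le> (\<integral>t. (f t - ?m)\<^sup>2 \<partial>lborel01)" by simp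
  also have "\<dots> = (\<integral>t. (f t)\<^sup>2 - 2 * ?m * f t + ?m\<^sup>2 \<partial>lborel01)"
    by (intro Bochner_Integration.integral_cong) (auto simp: power2_diff)
  also have "\<dots> = (\<integral>t. (f t)\<^sup>2 \<partial>lborel01) - 2 * ?m * ?m + ?m\<^sup>2"
    using L2D(2)[OF f] L2_integrable[OF f] by simp
  finally show ?thesis by (simp add: power2_eq_square)
qed

text \<open>The set where the functions differ is open, and a nonempty open set is not Lebesgue
  null.\<close>

lemma AE01_continuous_eq:
  fixes f g :: "real \<Rightarrow> real"
  assumes "continuous_on {0<..<1} f" "continuous_on {0<..<1} g"
    and ae: "AE t in lborel01. f t = g t" and t: "t \<in> {0<..<1}"
  shows "f t = g t"
proof (rule ccontr)
  assume ne: "f t \<noteq> g t"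
  have "continuous_on {0<..<1} (\<lambda>t. f t - g t)" by (intro continuous_intros assms)
  then have "open ((\<lambda>t. f t - g t) -` (- {0}) \<inter> {0<..<1})"
    by (rule continuous_on_open_vimage[THEN iffD1, rule_format, rotated]) auto
  then have op: "open {t \<in> {0<..<1}. f t \<noteq> g t}"
    by (rule back_subst[where P="open"]) auto
  have "AE t in lborel. t \<notin> {t \<in> {0<..<1}. f t \<noteq> g t}"
    using ae unfolding AE01 by eventually_elim auto
  then have "{t \<in> {0<..<1}. f t \<noteq> g t} \<in> null_sets lborel"
    using op by (subst AE_iff_null_sets) auto
  moreover have "{t \<in> {0<..<1}. f t \<noteq> g t} \<noteq> {}" using t ne by auto
  ultimately show False
    using op open_not_negligible[of "{t \<in> {0<..<1}. f t \<noteq> g t}"]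
    by (auto simp: negligible_iff_null_sets null_sets_completionI)
qed

text \<open>The fundamental theorem yields the Henstock-Kurzweil integral from interior derivatives
  alone. Integrability then identifies it with the Lebesgue integral, so \<open>F'\<close> may blow
  up at the end points.\<close>

lemma integral01_FTC:
  fixes F F' :: "real \<Rightarrow> real"
  assumes "continuous_on {0..1} F"
    and "\<And>t. t \<in> {0<..<1} \<Longrightarrow> (F has_real_derivative F' t) (at t)"
    and "integrable lborel01 F'"
  shows "(\<integral>t. F' t \<partial>lborel01) = F 1 - F 0"
proof -
  have "(F' has_integral (F 1 - F 0)) {0..1}"
    by (rule fundamental_theorem_of_calculus_interior)
       (use assms in \<open>auto simp: has_real_derivative_iff_has_vector_derivative\<close>)
  then have "integral {0<..<1} F' = F 1 - F 0"
    by (metis integral_open_interval_real integral_unique)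
  moreover have "set_integrable lborel {0<..<1} F'" using assms(3) by (simp add: set_integrable01)
  ultimately show ?thesis
    using set_borel_integral_eq_integral(2) by (metis LBINT01)
qed

text \<open>The positive and the negative part of \<open>f\<close> are densities of two measures
  that are finite and equal on all rays. Hence the measures agree, and so do their densities almost
  everywhere.\<close>

lemma AE_zero_of_intervals:
  fixes f :: "real \<Rightarrow> real"
  assumes f: "integrable lborel f"
    and zero: "\<And>a. (LBINT t:{a<..}. f t) = 0"
  shows "AE t in lborel. f t = 0"
proof -
  note [measurable] = borel_measurable_integrable[OF f]
  let ?p = "\<lambda>t. ennreal (f t)" and ?n = "\<lambda>t. ennreal (- f t)"
  have fin: "set_nn_integral lborel S ?p < \<infinity>" if "S \<in> sets borel" for S
  proof -
    have "set_nn_integral lborel S ?p \<le> (\<integral>\<^sup>+t. norm (f t) \<partial>lborel)"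
      by (intro nn_integral_mono) (auto simp: indicator_def intro!: ennreal_leI)
    also have "\<dots> < \<infinity>" using f by (simp add: integrable_iff_bounded)
    finally show ?thesis .
  qed
  have *: "set_nn_integral lborel {a<..} ?p = set_nn_integral lborel {a<..} ?n" for a
  proof -
    have i: "integrable lborel (\<lambda>t. indicator {a<..} t * f t)"
      using integrable_mult_indicator[OF _ f, of "{a<..}"] by simp
    let ?g = "\<lambda>t. indicator {a<..} t * f t"
    have "integral\<^sup>L lborel ?g = enn2real (\<integral>\<^sup>+t. ?g t \<partial>lborel) - enn2real (\<integral>\<^sup>+t. - ?g t \<partial>lborel)"
      by (rule real_lebesgue_integral_def[OF i])
    moreover have "integral\<^sup>L lborel ?g = 0" using zero[of a] by (simp add: set_lebesgue_integral_def)
    moreover have "(\<integral>\<^sup>+t. ?g t \<partial>lborel) < \<infinity>" "(\<integral>\<^sup>+t. - ?g t \<partial>lborel) < \<infinity>"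
      using i by (auto simp: real_integrable_def less_top)
    ultimately have "(\<integral>\<^sup>+t. ?g t \<partial>lborel) = (\<integral>\<^sup>+t. - ?g t \<partial>lborel)"
      by (metis diff_eq_eq add_0 ennreal_enn2real infinity_ennreal_def)
    moreover have "(\<integral>\<^sup>+t. ?g t \<partial>lborel) = set_nn_integral lborel {a<..} ?p"
      by (intro nn_integral_cong) (auto simp: indicator_def)
    moreover have "(\<integral>\<^sup>+t. - ?g t \<partial>lborel) = set_nn_integral lborel {a<..} ?n"
      by (intro nn_integral_cong) (auto simp: indicator_def)
    ultimately show ?thesis by simp
  qed
  have "density lborel ?p = density lborel ?n"
    by (rule measure_eqI_lessThan) (use fin in \<open>auto simp: emeasure_density *[symmetric]\<close>)
  then have "AE t in lborel. ?p t = ?n t"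
    by (subst (asm) sigma_finite_measure.density_unique_iff[OF sigma_finite_lborel]) auto
  then show ?thesis
  proof eventually_elim
    case (elim t)
    then show ?case by (cases "f t \<ge> 0") (auto simp: ennreal_neg ennreal_eq_0_iff)
  qed
qed

section \<open>Test functions and weak derivatives\<close>

lemma integral01_continuous:
  fixes f :: "real \<Rightarrow> real"
  assumes "continuous_on {0..1} f"
  shows "integral\<^sup>L lborel01 f = integral {0..1} f"
  using set_borel_integral_eq_integral(2)[of "{0<..<1}" f] L2_integrable[OF L2_continuous[OF assms]]
  by (simp add: set_integrable01 LBINT01 integral_open_interval_real)

text \<open>Squaring smooths the corner of the truncation: at 0 the difference quotient is bounded
  by \<open>norm h\<close>. This makes the cut-offs below continuously differentiable.\<close>

lemma max0_square_has_derivative: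
  "((\<lambda>x::real. (max 0 x)\<^sup>2) has_real_derivative 2 * max 0 x) (at x)"
proof -
  consider "x < 0" | "x = 0" | "x > 0" by linarith
  then show ?thesis
  proof cases
    case 1
    have "((\<lambda>x::real. 0) has_real_derivative 0) (at x)" by simp
    then show ?thesis
      by (rule has_field_derivative_transform_within_open[where S="{..<0}", THEN DERIV_cong]) (use 1 in auto)
  next
    case 2
    have "((\<lambda>h::real. (max 0 h)\<^sup>2 / h) \<longlongrightarrow> 0) (at 0)"
    proof (rule tendsto_norm_zero_cancel, rule tendsto_sandwich[of "\<lambda>_. 0" _ _ "\<lambda>h. norm h"])
      have "norm ((max 0 h)\<^sup>2 / h) \<le> norm h" for h :: real
        by (cases "0 \<le> h") (auto simp: max_def power2_eq_square)
      then show "\<forall>\<^sub>F h in at 0. norm ((max 0 h)\<^sup>2 / h) \<le> norm (h::real)"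
        by (intro always_eventually allI)
      show "((\<lambda>h::real. norm h) \<longlongrightarrow> 0) (at 0)" using tendsto_norm_zero[OF tendsto_ident_at] .
    qed auto
    then show ?thesis using 2 by (simp add: DERIV_def)
  next
    case 3
    have "((\<lambda>x::real. x\<^sup>2) has_real_derivative 2 * x) (at x)" by (auto intro!: derivative_eq_intros)
    then show ?thesis
      by (rule has_field_derivative_transform_within_open[where S="{0<..}", THEN DERIV_cong]) (use 3 in auto)
  qed
qed

lemma C1_differentiable_onI:
  fixes f :: "real \<Rightarrow> real"
  assumes "\<And>t. t \<in> S \<Longrightarrow> (f has_real_derivative f' t) (at t)" "continuous_on S f'"
  shows "f C1_differentiable_on S"
  using assms by (auto simp: C1_differentiable_on_def has_real_derivative_iff_has_vector_derivative)

lemma C1_differentiable_onD: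
  fixes f :: "real \<Rightarrow> real"
  assumes "f C1_differentiable_on S"
  shows "\<And>t. t \<in> S \<Longrightarrow> (f has_real_derivative deriv f t) (at t)" and "continuous_on S (deriv f)"
proof -
  obtain D where D: "\<And>t. t \<in> S \<Longrightarrow> (f has_real_derivative D t) (at t)" "continuous_on S D"
    using assms by (auto simp: C1_differentiable_on_def has_real_derivative_iff_has_vector_derivative)
  moreover have "deriv f t = D t" if "t \<in> S" for t using D(1)[OF that] by (rule DERIV_imp_deriv)
  ultimately show "\<And>t. t \<in> S \<Longrightarrow> (f has_real_derivative deriv f t) (at t)" "continuous_on S (deriv f)"
    by (auto cong: continuous_on_cong)
qed

text \<open>With q the squared truncation this is n q / (1 + n q): a C1 function vanishing outside
  (a, b), with values in [0, 1], that tends to 1 on (a, b) as n grows.\<close>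

definition bump :: "real \<Rightarrow> real \<Rightarrow> nat \<Rightarrow> real \<Rightarrow> real" where
  "bump a b n t = 1 - 1 / (1 + real n * (max 0 ((t - a) * (b - t)))\<^sup>2)"

lemma bump_test_fun:
  assumes "0 < a" "b < 1" "a < b"
  shows "bump a b n \<in> test_fun"
proof -
  let ?q = "\<lambda>t. (max 0 ((t - a) * (b - t)))\<^sup>2"
  let ?q' = "\<lambda>t. 2 * max 0 ((t - a) * (b - t)) * ((b - t) - (t - a))"
  have q: "(?q has_real_derivative ?q' t) (at t)" for t
    by (rule DERIV_chain2[OF max0_square_has_derivative, THEN DERIV_cong])
       (auto intro!: derivative_eq_intros)
  have pos: "1 + real n * ?q t > 0" for t
    by (intro add_pos_nonneg) auto
  have "(bump a b n has_real_derivative real n * ?q' t / (1 + real n * ?q t)\<^sup>2) (at t)" for t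
    unfolding bump_def[abs_def]
    by (rule derivative_eq_intros q refl | use pos[of t] in \<open>force simp: power2_eq_square\<close>)+
  moreover have "continuous_on UNIV (\<lambda>t. real n * ?q' t / (1 + real n * ?q t)\<^sup>2)"
    using pos by (intro continuous_intros) (auto simp: less_le)
  ultimately have "bump a b n C1_differentiable_on UNIV"
    by (intro C1_differentiable_onI)
  moreover have "bump a b n t = 0" if "t \<notin> {a..b}" for t
  proof -
    have "(t - a) * (b - t) \<le> 0" using that assms(3) by (auto simp: mult_le_0_iff)
    then show ?thesis by (simp add: bump_def max_def)
  qed
  moreover have "compact {a..b}" "{a..b} \<subseteq> {0<..<1}" using assms by auto
  ultimately show ?thesis unfolding test_fun_def by blast
qed

lemma bump_bounded: "\<bar>bump a b n t\<bar> \<le> 1"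
proof -
  have "1 \<le> 1 + real n * (max 0 ((t - a) * (b - t)))\<^sup>2" by simp
  then show ?thesis unfolding bump_def by (simp add: abs_le_iff divide_le_eq)
qed

lemma bump_limit:
  "(\<lambda>n. bump a b n t) \<longlonglongrightarrow> (if (t - a) * (b - t) > 0 then 1 else 0)"
proof (cases "(t - a) * (b - t) > 0")
  case True
  let ?c = "(max 0 ((t - a) * (b - t)))\<^sup>2"
  have c: "?c > 0" using True by (auto simp: max_def)
  have "filterlim (\<lambda>n. real n * ?c) at_top sequentially"
    by (rule filterlim_at_top_mult_tendsto_pos[OF tendsto_const c filterlim_real_sequentially, THEN filterlim_cong[THEN iffD1, rotated -1]]) auto
  then have "filterlim (\<lambda>n. 1 + real n * ?c) at_top sequentially"
    by (rule filterlim_tendsto_add_at_top[OF tendsto_const])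
  then have "(\<lambda>n. 1 / (1 + real n * ?c)) \<longlonglongrightarrow> 0"
    by (intro tendsto_divide_0[OF tendsto_const] filterlim_at_top_imp_at_infinity)
  then have "(\<lambda>n. 1 - 1 / (1 + real n * ?c)) \<longlonglongrightarrow> 1 - 0"
    by (intro tendsto_diff tendsto_const)
  then show ?thesis using True by (simp add: bump_def)
qed (simp add: bump_def max_def)

section \<open>Test functions and local integrability\<close>

lemma test_funE:
  assumes "\<eta> \<in> test_fun"
  obtains K where "compact K" "K \<subseteq> {0<..<1}" "\<And>t. t \<notin> K \<Longrightarrow> \<eta> t = 0" "\<And>t. t \<notin> K \<Longrightarrow> deriv \<eta> t = 0"
    "\<And>t. (\<eta> has_real_derivative deriv \<eta> t) (at t)" "continuous_on UNIV (deriv \<eta>)" "continuous_on UNIV \<eta>"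
proof -
  obtain K where K: "\<eta> C1_differentiable_on UNIV" "compact K" "K \<subseteq> {0<..<1}" "\<And>t. t \<notin> K \<Longrightarrow> \<eta> t = 0"
    using assms by (auto simp: test_fun_def)
  have d: "(\<eta> has_real_derivative deriv \<eta> t) (at t)" for t
    using C1_differentiable_onD(1)[OF K(1)] by simp
  have c: "continuous_on UNIV \<eta>"
    using d DERIV_isCont continuous_at_imp_continuous_on by blast
  have "deriv \<eta> t = 0" if "t \<notin> K" for t
  proof (rule DERIV_imp_deriv)
    have "((\<lambda>t. 0) has_real_derivative 0) (at t)" by simp
    then show "(\<eta> has_real_derivative 0) (at t)"
      by (rule has_field_derivative_transform_within_open[where S="- K"])
         (use that K in \<open>auto intro!: compact_imp_closed\<close>)
  qed
  with K d c C1_differentiable_onD(2)[OF K(1)] that show thesis by blast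
qed

lemma test_fun_L2:
  assumes "\<eta> \<in> test_fun"
  shows "\<eta> \<in> L2" "deriv \<eta> \<in> L2"
  using test_funE[OF assms] by (metis L2_continuous continuous_on_subset top_greatest)+

text \<open>As \<open>k\<close> vanishes off \<open>K\<close>, the product is the bounded function
  \<open>k\<close> times the integrable truncation of \<open>g\<close> to \<open>K\<close>.\<close>

lemma loc_integrable_mult:
  assumes g: "loc_integrable g" and K: "compact K" "K \<subseteq> {0<..<1}" "\<And>t. t \<notin> K \<Longrightarrow> k t = 0"
    and k: "continuous_on UNIV k"
  shows "integrable lborel01 (\<lambda>t. g t * k t)"
proof -
  have gi: "integrable lborel (\<lambda>t. indicator K t * g t)"
    using g K by (auto simp: loc_integrable_def set_integrable_def)
  obtain B where B: "\<And>t. t \<in> {0..1} \<Longrightarrow> \<bar>k t\<bar> \<le> B"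
    using bounded01_continuous[OF continuous_on_subset[OF k]] by (metis top_greatest)
  have B': "\<bar>k t\<bar> \<le> B" for t
  proof (cases "t \<in> K")
    case True then show ?thesis using K B[of t] by auto
  next
    case False then show ?thesis using K B[of 0] by auto
  qed
  have [measurable]: "k \<in> borel_measurable borel" by (rule borel_measurable_continuous_onI[OF k])
  have [measurable]: "(\<lambda>t. indicator K t * g t) \<in> borel_measurable lborel" using gi by auto
  have "integrable lborel (\<lambda>t. k t * (indicator K t * g t))"
  proof (rule Bochner_Integration.integrable_bound)
    show "integrable lborel (\<lambda>t. B * (indicator K t * g t))" using gi by simp
    have "\<bar>k t\<bar> * \<bar>x\<bar> \<le> \<bar>B\<bar> * \<bar>x\<bar>" for t x using B'[of t] by (intro mult_right_mono) auto
    then have "norm (k t * (indicator K t * g t)) \<le> norm (B * (indicator K t * g t))" for t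
      unfolding real_norm_def abs_mult[of "k t"] abs_mult[of B] .
    then show "AE t in lborel. norm (k t * (indicator K t * g t)) \<le> norm (B * (indicator K t * g t))"
      by (intro AE_I2)
  qed measurable
  also have "(\<lambda>t. k t * (indicator K t * g t)) = (\<lambda>t. indicator {0<..<1} t *\<^sub>R (g t * k t))"
    using K by (auto simp: indicator_def fun_eq_iff)
  finally show ?thesis by (simp add: lborel01_def integrable_restrict_space)
qed

lemma loc_integrable_test_fun:
  assumes "loc_integrable g" "\<eta> \<in> test_fun"
  shows "integrable lborel01 (\<lambda>t. g t * \<eta> t)" "integrable lborel01 (\<lambda>t. g t * deriv \<eta> t)"
  by (rule test_funE[OF assms(2)], rule loc_integrable_mult[OF assms(1)], auto)+

lemma loc_integrable_continuous:
  fixes f :: "real \<Rightarrow> real"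
  assumes "continuous_on {0<..<1} f"
  shows "loc_integrable f"
  unfolding loc_integrable_def set_integrable_def
  using borel_integrable_compact[OF _ continuous_on_subset[OF assms]] by blast

lemma loc_integrable_lincomb:
  assumes "loc_integrable f" "loc_integrable g"
  shows "loc_integrable (\<lambda>t. f t + c * g t)"
  using assms by (auto simp: loc_integrable_def)

text \<open>Local integrability gives information only on compact subintervals, which are made to
  exhaust (0,1). A positive shift of \<open>n\<close> keeps index 0 away from
  \<open>1 / 0 = 0\<close>, which would give the whole interval.\<close>

lemma interior01_exhaustion:
  assumes "t \<in> {0<..<1::real}"
  shows "\<forall>\<^sub>F n in sequentially. t \<in> {1 / real (n + 2)<..<1 - 1 / real (n + 2)}"
proof -
  have lim: "(\<lambda>n. 1 / real (n + 2)) \<longlonglongrightarrow> 0"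
    using LIMSEQ_ignore_initial_segment[OF lim_1_over_n, of 2] by simp
  have "\<forall>\<^sub>F n in sequentially. 1 / real (n + 2) < min t (1 - t)"
    using order_tendstoD(2)[OF lim, of "min t (1 - t)"] assms by simp
  then show ?thesis by eventually_elim auto
qed

lemma loc_integrable_measurable:
  assumes "loc_integrable g"
  shows "g \<in> borel_measurable lborel01"
proof (rule borel_measurable_LIMSEQ_real)
  let ?K = "\<lambda>n::nat. {1 / real (n + 2)..1 - 1 / real (n + 2)}"
  fix t assume t: "t \<in> space lborel01"
  have "\<forall>\<^sub>F n in sequentially. indicator (?K n) t * g t = g t"
    by (rule eventually_mono[OF interior01_exhaustion]) (use t in auto)
  then show "(\<lambda>n. indicator (?K n) t * g t) \<longlonglongrightarrow> g t" by (rule tendsto_eventually)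
next
  fix n :: nat
  let ?K = "{1 / real (n + 2)..1 - 1 / real (n + 2)}"
  have "0 < 1 / real (n + 2)" by simp
  then have "?K \<subseteq> {0<..<1}" unfolding subset_iff atLeastAtMost_iff greaterThanLessThan_iff by linarith
  then have "integrable lborel (\<lambda>t. indicator ?K t * g t)"
    using assms by (auto simp: loc_integrable_def set_integrable_def)
  then have "(\<lambda>t. indicator ?K t * g t) \<in> borel_measurable borel" by auto
  then show "(\<lambda>t. indicator ?K t * g t) \<in> borel_measurable lborel01"
    unfolding lborel01_def by (intro measurable_restrict_space1) auto
qed

text \<open>The bumps converge boundedly to the indicator of an interval, so by dominated
  convergence \<open>d\<close> integrates to 0 over every interval whose closure lies in (0,1). Such
  intervals determine \<open>d\<close> almost everywhere.\<close>

lemma fundamental_lemma: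
  assumes d: "loc_integrable d"
    and zero: "\<And>\<eta>. \<eta> \<in> test_fun \<Longrightarrow> (\<integral>t. d t * \<eta> t \<partial>lborel01) = 0"
  shows "AE t in lborel01. d t = 0"
proof -
  have int: "set_integrable lborel {a<..<b} d" if "0 < a" "b < 1" for a b
  proof (rule set_integrable_subset)
    show "set_integrable lborel {a..b} d" using that d unfolding loc_integrable_def by (elim allE[of _ "{a..b}"]) auto
  qed auto
  have interval: "(LBINT t:{a<..<b}. d t) = 0" if ab: "0 < a" "b < 1" for a b
  proof (cases "a < b")
    case True
    have i: "integrable lborel (\<lambda>t. indicator {a<..<b} t * d t)"
      using int[OF ab] by (simp add: set_integrable_def)
    have bi: "(\<integral>t. d t * bump a b n t \<partial>lborel01) = (\<integral>t. bump a b n t * (indicator {a<..<b} t * d t) \<partial>lborel)" for n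
    proof -
      have "bump a b n t = 0" if "t \<notin> {a<..<b}" for t
      proof -
        have "(t - a) * (b - t) \<le> 0" using that True by (auto simp: mult_le_0_iff)
        then show ?thesis by (simp add: bump_def max_def)
      qed
      then show ?thesis using ab
        by (auto simp: lborel01_def integral_restrict_space indicator_def intro!: Bochner_Integration.integral_cong)
    qed
    have [measurable]: "bump a b n \<in> borel_measurable borel" for n
      by (rule test_funE[OF bump_test_fun[OF ab True]]) (rule borel_measurable_continuous_onI)
    have [measurable]: "(\<lambda>t. indicator {a<..<b} t * d t) \<in> borel_measurable lborel" using i by auto
    have "(\<lambda>n. \<integral>t. bump a b n t * (indicator {a<..<b} t * d t) \<partial>lborel)
            \<longlonglongrightarrow> (\<integral>t. indicator {a<..<b} t * d t \<partial>lborel)"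
    proof (rule integral_dominated_convergence[where w="\<lambda>t. norm (indicator {a<..<b} t * d t)"])
      show "AE t in lborel. norm (bump a b n t * (indicator {a<..<b} t * d t)) \<le> norm (indicator {a<..<b} t * d t)" for n
        by (intro AE_I2)
           (metis abs_ge_zero abs_mult bump_bounded mult_1 mult_right_mono real_norm_def)
      show "AE t in lborel. (\<lambda>n. bump a b n t * (indicator {a<..<b} t * d t)) \<longlonglongrightarrow> indicator {a<..<b} t * d t"
      proof (rule AE_I2)
        fix t
        show "(\<lambda>n. bump a b n t * (indicator {a<..<b} t * d t)) \<longlonglongrightarrow> indicator {a<..<b} t * d t"
        proof (cases "t \<in> {a<..<b}")
          case True
          then have "(\<lambda>n. bump a b n t) \<longlonglongrightarrow> 1" using bump_limit[of a b t] by simp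
          from tendsto_mult_right[OF this, of "indicator {a<..<b} t * d t"] show ?thesis by simp
        qed simp
      qed
    qed (use i in auto)
    moreover have "(\<integral>t. bump a b n t * (indicator {a<..<b} t * d t) \<partial>lborel) = 0" for n
      using zero[OF bump_test_fun[OF ab True, of n]] bi by simp
    ultimately have "(\<integral>t. indicator {a<..<b} t * d t \<partial>lborel) = 0"
      by (simp add: LIMSEQ_const_iff)
    then show ?thesis by (simp add: set_lebesgue_integral_def)
  qed (simp add: set_lebesgue_integral_def)
  have ae: "AE t in lborel. t \<in> {a<..<b} \<longrightarrow> d t = 0" if ab: "0 < a" "b < 1" for a b
  proof -
    \<comment> \<open>\<open>d\<close> is only locally integrable, so the criterion on rays is
      applied to a truncation; intersecting a ray with {a<..<b} gives again an interval already
      treated.\<close>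
    have "AE t in lborel. indicator {a<..<b} t * d t = 0"
    proof (rule AE_zero_of_intervals)
      show "integrable lborel (\<lambda>t. indicator {a<..<b} t * d t)"
        using int[OF ab] by (simp add: set_integrable_def)
      fix c
      have "(LBINT t:{c<..}. indicator {a<..<b} t * d t) = (LBINT t:{max a c<..<b}. d t)"
        unfolding set_lebesgue_integral_def
        by (intro Bochner_Integration.integral_cong) (auto simp: indicator_def)
      then show "(LBINT t:{c<..}. indicator {a<..<b} t * d t) = 0" using interval[of "max a c" b] ab by simp
    qed
    then show ?thesis by eventually_elim (auto simp: indicator_def)
  qed
  have "AE t in lborel. \<forall>n. t \<in> {1 / real (n + 2)<..<1 - 1 / real (n + 2)} \<longrightarrow> d t = 0"
    by (subst AE_all_countable, rule allI, rule ae) simp_all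
  then show ?thesis
    unfolding AE01
  proof eventually_elim
    case (elim t)
    show ?case
    proof
      assume "t \<in> {0<..<1}"
      then obtain n where "t \<in> {1 / real (n + 2)<..<1 - 1 / real (n + 2)}"
        using interior01_exhaustion[of t] eventually_sequentially by force
      then show "d t = 0" using elim by blast
    qed
  qed
qed

section \<open>Weak derivatives: uniqueness, linearity, the classical case\<close>

lemma has_weak_derivative01:
  "has_weak_derivative f g \<longleftrightarrow> loc_integrable f \<and> loc_integrable g \<and>
     (\<forall>\<eta>\<in>test_fun. (\<integral>t. f t * deriv \<eta> t \<partial>lborel01) = - (\<integral>t. g t * \<eta> t \<partial>lborel01))"
  by (simp add: has_weak_derivative_def LBINT01)

lemma has_weak_derivative_unique:
  assumes "has_weak_derivative f g" "has_weak_derivative f k"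
  shows "AE t in lborel01. g t = k t"
proof -
  have "AE t in lborel01. g t + (-1) * k t = 0"
  proof (rule fundamental_lemma)
    show "loc_integrable (\<lambda>t. g t + (-1) * k t)"
      using assms by (intro loc_integrable_lincomb) (auto simp: has_weak_derivative_def)
    fix \<eta> assume \<eta>: "\<eta> \<in> test_fun"
    have "(\<integral>t. (g t + (-1) * k t) * \<eta> t \<partial>lborel01) = (\<integral>t. g t * \<eta> t - k t * \<eta> t \<partial>lborel01)"
      by (simp add: algebra_simps)
    also have "\<dots> = (\<integral>t. g t * \<eta> t \<partial>lborel01) - (\<integral>t. k t * \<eta> t \<partial>lborel01)"
      using assms \<eta> by (intro Bochner_Integration.integral_diff loc_integrable_test_fun)
                        (auto simp: has_weak_derivative_def)
    also have "\<dots> = 0" using assms \<eta> by (auto simp: has_weak_derivative01)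
    finally show "(\<integral>t. (g t + (-1) * k t) * \<eta> t \<partial>lborel01) = 0" .
  qed
  then show ?thesis by simp
qed

lemma has_weak_derivative_weak_deriv:
  "has_weak_derivative f g \<Longrightarrow> has_weak_derivative f (weak_deriv f)"
  using someI[of "has_weak_derivative f" g] by (simp add: weak_deriv_def)

text \<open>Frees all later computations from the \<open>SOME\<close> in \<open>weak_deriv\<close>:
  any explicit weak derivative may replace it under an integral.\<close>

lemma weak_deriv_AE:
  "has_weak_derivative f g \<Longrightarrow> AE t in lborel01. weak_deriv f t = g t"
  by (rule has_weak_derivative_unique[OF has_weak_derivative_weak_deriv])

lemma has_weak_derivative_lincomb:
  assumes f: "has_weak_derivative f f'" and g: "has_weak_derivative g g'"
  shows "has_weak_derivative (\<lambda>t. f t + c * g t) (\<lambda>t. f' t + c * g' t)"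
  unfolding has_weak_derivative01
proof (intro conjI ballI)
  have *: "(\<integral>t. (u t + c * v t) * k t \<partial>lborel01) = (\<integral>t. u t * k t \<partial>lborel01) + c * (\<integral>t. v t * k t \<partial>lborel01)"
    if "integrable lborel01 (\<lambda>t. u t * k t)" "integrable lborel01 (\<lambda>t. v t * k t)" for u v k :: "real \<Rightarrow> real"
  proof -
    have "(\<integral>t. (u t + c * v t) * k t \<partial>lborel01) = (\<integral>t. u t * k t + c * (v t * k t) \<partial>lborel01)"
      by (simp add: algebra_simps)
    also have "\<dots> = (\<integral>t. u t * k t \<partial>lborel01) + c * (\<integral>t. v t * k t \<partial>lborel01)"
      using that by simp
    finally show ?thesis .
  qed
  show "loc_integrable (\<lambda>t. f t + c * g t)" "loc_integrable (\<lambda>t. f' t + c * g' t)"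
    using f g by (auto intro!: loc_integrable_lincomb simp: has_weak_derivative_def)
  fix \<eta> assume \<eta>: "\<eta> \<in> test_fun"
  have li: "loc_integrable f" "loc_integrable g" "loc_integrable f'" "loc_integrable g'"
    using f g by (auto simp: has_weak_derivative_def)
  show "(\<integral>t. (f t + c * g t) * deriv \<eta> t \<partial>lborel01) = - (\<integral>t. (f' t + c * g' t) * \<eta> t \<partial>lborel01)"
    using f g \<eta> li loc_integrable_test_fun[OF _ \<eta>]
    by (simp add: * has_weak_derivative01)
qed

text \<open>Integration by parts. \<open>f\<close> may be singular at 0 and 1, but its product with
  a test function vanishes outside a compact subset of (0,1), so it is differentiable on the whole
  line and the boundary terms are 0.\<close>

lemma has_weak_derivative_C1:
  fixes f :: "real \<Rightarrow> real"
  assumes f: "\<And>t. t \<in> {0<..<1} \<Longrightarrow> (f has_real_derivative f' t) (at t)"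
    and f': "continuous_on {0<..<1} f'"
  shows "has_weak_derivative f f'"
  unfolding has_weak_derivative01
proof (intro conjI ballI)
  have "continuous_on {0<..<1} f"
    by (meson DERIV_isCont f continuous_at_imp_continuous_on)
  then show li: "loc_integrable f" "loc_integrable f'"
    using f' by (auto intro: loc_integrable_continuous)
  fix \<eta> assume \<eta>: "\<eta> \<in> test_fun"
  then obtain K where K: "compact K" "K \<subseteq> {0<..<1}" "\<And>t. t \<notin> K \<Longrightarrow> \<eta> t = 0" "\<And>t. t \<notin> K \<Longrightarrow> deriv \<eta> t = 0"
    and d: "\<And>t. (\<eta> has_real_derivative deriv \<eta> t) (at t)"
    by (rule test_funE) blast
  have F: "((\<lambda>t. f t * \<eta> t) has_real_derivative f' t * \<eta> t + f t * deriv \<eta> t) (at t)" for t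
  proof (cases "t \<in> {0<..<1}")
    case True
    show ?thesis using DERIV_mult[OF f[OF True] d[of t]] by (simp add: algebra_simps)
  next
    case False
    have "((\<lambda>t. 0) has_real_derivative 0) (at t)" by simp
    then have "((\<lambda>t. f t * \<eta> t) has_real_derivative 0) (at t)"
      by (rule has_field_derivative_transform_within_open[where S="- K"])
         (use False K in \<open>auto intro!: compact_imp_closed\<close>)
    moreover have "t \<notin> K" using False K(2) by blast
    ultimately show ?thesis using K(3,4) by simp
  qed
  note i = loc_integrable_test_fun[OF _ \<eta>, OF li(1)] loc_integrable_test_fun[OF _ \<eta>, OF li(2)]
  have "(\<integral>t. f' t * \<eta> t + f t * deriv \<eta> t \<partial>lborel01) = f 1 * \<eta> 1 - f 0 * \<eta> 0"
    by (rule integral01_FTC[where F="\<lambda>t. f t * \<eta> t"])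
       (use F i in \<open>auto intro!: continuous_at_imp_continuous_on DERIV_isCont\<close>)
  also have "\<dots> = 0"
  proof -
    have "0 \<notin> K" "1 \<notin> K" using K(2) by auto
    then show ?thesis using K(3) by simp
  qed
  finally show "(\<integral>t. f t * deriv \<eta> t \<partial>lborel01) = - (\<integral>t. f' t * \<eta> t \<partial>lborel01)"
    using i by simp
qed

section \<open>The spaces \<open>W12\<close> and \<open>W012\<close>\<close>

lemma W12_D:
  assumes "f \<in> W12"
  shows "f \<in> L2" "weak_deriv f \<in> L2" "has_weak_derivative f (weak_deriv f)"
proof -
  obtain g where g: "g \<in> L2" "has_weak_derivative f g" and f: "f \<in> L2"
    using assms by (auto simp: W12_def)
  show "f \<in> L2" by fact
  show w: "has_weak_derivative f (weak_deriv f)" using g(2) by (rule has_weak_derivative_weak_deriv)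
  then have "weak_deriv f \<in> borel_measurable lborel01"
    by (intro loc_integrable_measurable) (simp add: has_weak_derivative_def)
  moreover have "AE t in lborel01. (weak_deriv f t)\<^sup>2 \<le> (g t)\<^sup>2"
    using weak_deriv_AE[OF g(2)] by eventually_elim simp
  ultimately show "weak_deriv f \<in> L2"
    using L2D(2)[OF g(1)] by (intro L2_bound)
qed

lemma weak_deriv_measurable:
  "has_weak_derivative f g \<Longrightarrow> weak_deriv f \<in> borel_measurable lborel01"
  using has_weak_derivative_weak_deriv[of f g] loc_integrable_measurable
  by (simp add: has_weak_derivative_def)

lemma W12_norm_eq:
  assumes "has_weak_derivative f g" "g \<in> borel_measurable lborel01"
  shows "W12_norm f = sqrt ((\<integral>t. (f t)\<^sup>2 \<partial>lborel01) + (\<integral>t. (g t)\<^sup>2 \<partial>lborel01))"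
proof -
  note [measurable] = assms(2) weak_deriv_measurable[OF assms(1)]
  have "(\<integral>t. (weak_deriv f t)\<^sup>2 \<partial>lborel01) = (\<integral>t. (g t)\<^sup>2 \<partial>lborel01)"
    by (rule integral_cong_AE) (use weak_deriv_AE[OF assms(1)] in auto)
  then show ?thesis by (simp add: W12_norm_def LBINT01)
qed

lemma test_fun_has_weak_derivative:
  assumes "\<eta> \<in> test_fun"
  shows "has_weak_derivative \<eta> (deriv \<eta>)"
  by (rule test_funE[OF assms], rule has_weak_derivative_C1) (auto intro: continuous_on_subset)

lemma test_fun_W12: "\<eta> \<in> test_fun \<Longrightarrow> \<eta> \<in> W12"
  using test_fun_L2 test_fun_has_weak_derivative by (auto simp: W12_def)

lemma test_fun_W012:
  assumes "\<eta> \<in> test_fun"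
  shows "\<eta> \<in> W012"
proof -
  have "has_weak_derivative (\<lambda>t. \<eta> t - \<eta> t) (\<lambda>t. 0)"
    using has_weak_derivative_lincomb[OF test_fun_has_weak_derivative test_fun_has_weak_derivative, OF assms assms, of "-1"]
    by simp
  then have "W12_norm (\<lambda>t. \<eta> t - \<eta> t) = 0" by (subst W12_norm_eq[where g="\<lambda>_. 0"]) auto
  then show ?thesis
    using assms test_fun_W12[OF assms] unfolding W012_def by (auto intro!: exI[of _ "\<lambda>_. \<eta>"])
qed

lemma W012_approx:
  assumes "h \<in> W012"
  obtains \<eta> where "\<And>n::nat. \<eta> n \<in> test_fun"
    "(\<lambda>n. \<integral>t. (\<eta> n t - h t)\<^sup>2 \<partial>lborel01) \<longlonglongrightarrow> 0"
    "(\<lambda>n. \<integral>t. (deriv (\<eta> n) t - weak_deriv h t)\<^sup>2 \<partial>lborel01) \<longlonglongrightarrow> 0"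
proof -
  obtain \<eta> where h: "h \<in> W12" and \<eta>: "\<And>n::nat. \<eta> n \<in> test_fun"
    and lim: "(\<lambda>n. W12_norm (\<lambda>t. \<eta> n t - h t)) \<longlonglongrightarrow> 0"
    using assms by (auto simp: W012_def)
  let ?a = "\<lambda>n. \<integral>t. (\<eta> n t - h t)\<^sup>2 \<partial>lborel01"
  let ?b = "\<lambda>n. \<integral>t. (deriv (\<eta> n) t - weak_deriv h t)\<^sup>2 \<partial>lborel01"
  have "W12_norm (\<lambda>t. \<eta> n t - h t) = sqrt (?a n + ?b n)" for n
    using has_weak_derivative_lincomb[OF test_fun_has_weak_derivative[OF \<eta>] W12_D(3)[OF h], of n "-1"]
      L2D(1)[OF test_fun_L2(2)[OF \<eta>[of n]]] L2D(1)[OF W12_D(2)[OF h]]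
    by (intro W12_norm_eq) auto
  moreover have "(\<lambda>n. (W12_norm (\<lambda>t. \<eta> n t - h t))\<^sup>2) \<longlonglongrightarrow> 0"
    using tendsto_power[OF lim, of 2] by simp
  ultimately have s: "(\<lambda>n. ?a n + ?b n) \<longlonglongrightarrow> 0" by simp
  have "?a \<longlonglongrightarrow> 0" "?b \<longlonglongrightarrow> 0"
    by (rule tendsto_sandwich[OF _ _ tendsto_const s]; simp)+
  with \<eta> that show thesis by blast
qed

text \<open>A crude one-dimensional Sobolev inequality: \<eta> is the integral of its derivative
  from 0, and |x| \<le> 1 + x^2. The inhomogeneous form is enough, since only some finite bound is
  wanted.\<close>

lemma test_fun_bound:
  assumes "\<eta> \<in> test_fun"
  shows "\<bar>\<eta> t\<bar> \<le> 1 + (\<integral>s. (deriv \<eta> s)\<^sup>2 \<partial>lborel01)"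
proof (rule test_funE[OF assms])
  fix K assume K: "K \<subseteq> {0<..<1}" "\<And>t. t \<notin> K \<Longrightarrow> \<eta> t = 0"
    and d: "\<And>t. (\<eta> has_real_derivative deriv \<eta> t) (at t)" and c: "continuous_on UNIV (deriv \<eta>)"
  have c': "continuous_on S (deriv \<eta>)" for S using c continuous_on_subset by blast
  have nonneg: "0 \<le> (\<integral>s. (deriv \<eta> s)\<^sup>2 \<partial>lborel01)" by simp
  show ?thesis
  proof (cases "t \<in> K")
    case True
    then have t: "0 < t" "t < 1" using K by auto
    have eq: "integral {0..t} (deriv \<eta>) = \<eta> t - \<eta> 0"
      by (rule integral_unique, rule fundamental_theorem_of_calculus)
         (use t d in \<open>auto simp: has_real_derivative_iff_has_vector_derivative[symmetric]
            intro: has_field_derivative_at_within\<close>)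
    have le: "\<bar>x\<bar> \<le> 1 + x\<^sup>2" for x :: real
      using sum_squares_bound[of "\<bar>x\<bar>" 1] by (simp; smt (verit) abs_ge_zero)
    have "\<bar>\<eta> t\<bar> = norm (integral {0..t} (deriv \<eta>))"
    proof -
      have "0 \<notin> K" using K(1) by auto
      then show ?thesis using eq K(2)[of 0] by simp
    qed
    also have "\<dots> \<le> integral {0..t} (\<lambda>s. 1 + (deriv \<eta> s)\<^sup>2)"
      by (rule integral_norm_bound_integral)
         (auto intro!: integrable_continuous_real continuous_intros c' simp: le)
    also have "\<dots> \<le> integral {0..1} (\<lambda>s. 1 + (deriv \<eta> s)\<^sup>2)"
      by (rule integral_subset_le)
         (use t in \<open>auto intro!: integrable_continuous_real continuous_intros c'\<close>)
    also have "\<dots> = (\<integral>s. 1 + (deriv \<eta> s)\<^sup>2 \<partial>lborel01)"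
      by (rule integral01_continuous[symmetric]) (intro continuous_intros c')
    also have "\<dots> = 1 + (\<integral>s. (deriv \<eta> s)\<^sup>2 \<partial>lborel01)"
      using L2D(2)[OF test_fun_L2(2)[OF assms]] by simp
    finally show ?thesis .
  next
    case False
    then show ?thesis using K nonneg by simp
  qed
qed

text \<open>Stands in for the embedding into bounded functions. The bound keeps \<phi> + \<epsilon>
  h away from 0 for small \<epsilon>, without which the Gateaux derivative of \<open>G\<close> could
  not be computed.\<close>

lemma W012_bounded:
  assumes "h \<in> W012"
  obtains B where "B > 0" "AE t in lborel01. \<bar>h t\<bar> \<le> B"
proof -
  have h: "h \<in> W12" using assms by (simp add: W012_def)
  let ?h' = "weak_deriv h"
  note [measurable] = L2D(1)[OF W12_D(1)[OF h]]
  obtain \<eta> where \<eta>: "\<And>n::nat. \<eta> n \<in> test_fun"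
    and a: "(\<lambda>n. \<integral>t. (\<eta> n t - h t)\<^sup>2 \<partial>lborel01) \<longlonglongrightarrow> 0"
    and b: "(\<lambda>n. \<integral>t. (deriv (\<eta> n) t - ?h' t)\<^sup>2 \<partial>lborel01) \<longlonglongrightarrow> 0"
    by (rule W012_approx[OF assms]) blast
  \<comment> \<open>The leading 1 is that of \<open>test_fun_bound\<close>. The rest bounds the
    integral of the squared derivative of the approximant, by x^2 \<le> 2 (x - y)^2 + 2 y^2, once
    the approximation error is below 1.\<close>
  define C where "C = 1 + (2 + 2 * (\<integral>t. (?h' t)\<^sup>2 \<partial>lborel01))"
  have Cpos: "C > 0" unfolding C_def by (intro add_pos_nonneg) auto
  have hL: "?h' \<in> L2" using W12_D(2)[OF h] .
  have "\<forall>\<^sub>F n in sequentially. (\<integral>t. (deriv (\<eta> n) t - ?h' t)\<^sup>2 \<partial>lborel01) < 1"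
    using order_tendstoD(2)[OF b] by simp
  then have bound: "\<forall>\<^sub>F n in sequentially. \<forall>t. \<bar>\<eta> n t\<bar> \<le> C"
  proof eventually_elim
    case (elim n)
    have eL: "deriv (\<eta> n) \<in> L2" using test_fun_L2(2)[OF \<eta>] .
    note sq = L2D(2)[OF eL] L2D(2)[OF L2_diff[OF eL hL]] L2D(2)[OF hL]
    have "(\<integral>t. (deriv (\<eta> n) t)\<^sup>2 \<partial>lborel01) \<le>
          (\<integral>t. 2 * (deriv (\<eta> n) t - ?h' t)\<^sup>2 + 2 * (?h' t)\<^sup>2 \<partial>lborel01)"
    proof (rule integral_mono)
      have "x\<^sup>2 \<le> 2 * (x - y)\<^sup>2 + 2 * y\<^sup>2" for x y :: real
        using zero_le_power2[of "x - 2 * y"] by (simp add: power2_eq_square algebra_simps)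
      then show "(deriv (\<eta> n) t)\<^sup>2 \<le> 2 * (deriv (\<eta> n) t - ?h' t)\<^sup>2 + 2 * (?h' t)\<^sup>2" for t .
    qed (intro sq Bochner_Integration.integrable_add integrable_mult_right)+
    also have "\<dots> = 2 * (\<integral>t. (deriv (\<eta> n) t - ?h' t)\<^sup>2 \<partial>lborel01) + 2 * (\<integral>t. (?h' t)\<^sup>2 \<partial>lborel01)"
      using sq by (simp del: power2_diff)
    finally have "1 + (\<integral>t. (deriv (\<eta> n) t)\<^sup>2 \<partial>lborel01) \<le> C"
      using elim by (simp add: C_def)
    then show ?case using test_fun_bound[OF \<eta>[of n]] by (meson order_trans)
  qed
  \<comment> \<open>Where \<open>\<bar>h\<bar> > C + 1\<close>, the approximants stay at distance 1 from \<open>h\<close>.\<close>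
  let ?S = "{t \<in> space lborel01. \<bar>h t\<bar> > C + 1}"
  have S [measurable]: "?S \<in> sets lborel01" by measurable
  have Si: "integrable lborel01 (indicator ?S :: real \<Rightarrow> real)"
    by (rule integrable_real_indicator[OF S]) (metis infinity_ennreal_def less_top lborel01.emeasure_finite)
  have "\<forall>\<^sub>F n in sequentially. measure lborel01 ?S \<le> (\<integral>t. (\<eta> n t - h t)\<^sup>2 \<partial>lborel01)"
    using bound
  proof eventually_elim
    case (elim n)
    have dL: "(\<lambda>t. \<eta> n t - h t) \<in> L2"
      using L2_diff[OF test_fun_L2(1)[OF \<eta>] W12_D(1)[OF h]] .
    have "measure lborel01 ?S = (\<integral>t. indicator ?S t \<partial>lborel01)"
      by (simp, rule arg_cong[where f="measure lborel01"]) auto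
    also have "\<dots> \<le> (\<integral>t. (\<eta> n t - h t)\<^sup>2 \<partial>lborel01)"
    proof (rule integral_mono)
      fix t
      show "indicator ?S t \<le> (\<eta> n t - h t)\<^sup>2"
      proof (cases "t \<in> ?S")
        case True
        then have "1 \<le> \<bar>\<eta> n t - h t\<bar>" using elim[rule_format, of t] by auto
        then have "1\<^sup>2 \<le> \<bar>\<eta> n t - h t\<bar>\<^sup>2" by (rule power_mono) simp
        then show ?thesis using True by simp
      qed simp
    qed (rule Si, rule L2D(2)[OF dL])
    finally show ?case .
  qed
  then have "measure lborel01 ?S \<le> 0"
    by (rule tendsto_lowerbound[OF a]) simp
  then have "measure lborel01 ?S = 0" by (simp add: measure_le_0_iff)
  then have "?S \<in> null_sets lborel01"
    by (intro null_setsI S) (simp add: lborel01.emeasure_eq_measure)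
  then have "AE t in lborel01. \<bar>h t\<bar> \<le> C + 1"
    by (rule AE_I') auto
  with Cpos that[of "C + 1"] show thesis by simp
qed

section \<open>The Gateaux derivative\<close>

definition pot :: "real \<Rightarrow> real" where
  "pot s = (s\<^sup>2 - 1)\<^sup>2 + (s - 1)\<^sup>2"

definition dpot :: "real \<Rightarrow> real" where
  "dpot s = 4 * s * (s\<^sup>2 - 1) + 2 * (s - 1)"

lemma pot_nonneg: "0 \<le> pot s"
  by (simp add: pot_def)

lemma add_pot_pos: "m > 0 \<Longrightarrow> m + pot s > 0"
  using pot_nonneg[of s] by simp

lemma pot_has_derivative: "(pot has_real_derivative dpot s) (at s)"
  unfolding pot_def[abs_def] dpot_def
  by (auto intro!: derivative_eq_intros simp: power2_eq_square algebra_simps)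

lemma continuous_on_pot [continuous_intros]: "continuous_on S f \<Longrightarrow> continuous_on S (\<lambda>t. pot (f t))"
  unfolding pot_def by (intro continuous_intros)

lemma continuous_on_dpot [continuous_intros]: "continuous_on S f \<Longrightarrow> continuous_on S (\<lambda>t. dpot (f t))"
  unfolding dpot_def by (intro continuous_intros)

lemma pot_measurable [measurable]: "pot \<in> borel_measurable borel"
  unfolding pot_def[abs_def] by measurable

lemma dpot_measurable [measurable]: "dpot \<in> borel_measurable borel"
  unfolding dpot_def[abs_def] by measurable

lemma pot_bound: "\<bar>s\<bar> \<le> C \<Longrightarrow> \<bar>pot s\<bar> \<le> (C\<^sup>2 + 1)\<^sup>2 + (C + 1)\<^sup>2"
proof -
  assume s: "\<bar>s\<bar> \<le> C"
  have "\<bar>s\<bar>\<^sup>2 \<le> C\<^sup>2" using s by (intro power_mono) auto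
  then have "\<bar>s\<^sup>2 - 1\<bar> \<le> \<bar>C\<^sup>2 + 1\<bar>" using zero_le_power2[of s] unfolding power2_abs by linarith
  then have "(s\<^sup>2 - 1)\<^sup>2 \<le> (C\<^sup>2 + 1)\<^sup>2" by (simp only: abs_le_square_iff)
  moreover have "(s - 1)\<^sup>2 \<le> (C + 1)\<^sup>2" using s by (subst abs_le_square_iff[symmetric]) linarith
  ultimately show ?thesis using pot_nonneg[of s] by (simp add: pot_def)
qed

text \<open>\<open>pot\<close> is a quartic, so the remainder is an explicit polynomial with the
  factor x^2 and can be bounded termwise.\<close>

lemma pot_taylor:
  assumes "\<bar>s\<bar> \<le> C" "\<bar>x\<bar> \<le> M"
  shows "\<bar>pot (s + x) - pot s - x * dpot s\<bar> \<le> (6 * C\<^sup>2 + 1 + 4 * C * M + M\<^sup>2) * x\<^sup>2"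
proof -
  have eq: "pot (s + x) - pot s - x * dpot s = (6 * s\<^sup>2 - 1 + 4 * (s * x) + x\<^sup>2) * x\<^sup>2"
    by (simp add: pot_def dpot_def power2_eq_square algebra_simps)
  have "\<bar>s\<bar>\<^sup>2 \<le> C\<^sup>2" "\<bar>x\<bar>\<^sup>2 \<le> M\<^sup>2" using assms by (intro power_mono; simp)+
  moreover have "\<bar>s * x\<bar> \<le> C * M" unfolding abs_mult using assms by (intro mult_mono) auto
  ultimately have "\<bar>6 * s\<^sup>2 - 1 + 4 * (s * x) + x\<^sup>2\<bar> \<le> 6 * C\<^sup>2 + 1 + 4 * C * M + M\<^sup>2"
    unfolding power2_abs using zero_le_power2[of s] zero_le_power2[of x] by linarith
  then show ?thesis unfolding eq abs_mult by (simp add: mult_right_mono)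
qed

section \<open>The functionals as integrals over (0,1)\<close>

lemma J_eq:
  assumes [measurable]: "\<phi> \<in> borel_measurable lborel01" and C: "AE t in lborel01. \<bar>\<phi> t\<bar> \<le> C"
  shows "integrable lborel01 (\<lambda>t. pot (\<phi> t))" "J \<phi> = (\<integral>t. pot (\<phi> t) \<partial>lborel01)"
proof -
  let ?B = "(C\<^sup>2 + 1)\<^sup>2 + (C + 1)\<^sup>2"
  have p: "AE t in lborel01. \<bar>pot (\<phi> t)\<bar> \<le> ?B"
    using C by eventually_elim (rule pot_bound)
  show "integrable lborel01 (\<lambda>t. pot (\<phi> t))"
    by (rule lborel01.integrable_const_bound[where B="?B"]) (use p in auto)
  have le: "((\<phi> t)\<^sup>2 - 1)\<^sup>2 \<le> pot (\<phi> t)" "(\<phi> t - 1)\<^sup>2 \<le> pot (\<phi> t)" for t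
    by (simp_all add: pot_def)
  have "AE t in lborel01. norm (((\<phi> t)\<^sup>2 - 1)\<^sup>2) \<le> ?B"
    using p by eventually_elim (use le(1) in \<open>smt (verit) real_norm_def zero_le_power2\<close>)
  then have "integrable lborel01 (\<lambda>t. ((\<phi> t)\<^sup>2 - 1)\<^sup>2)"
    by (rule lborel01.integrable_const_bound) measurable
  moreover have "AE t in lborel01. norm ((\<phi> t - 1)\<^sup>2) \<le> ?B"
    using p by eventually_elim (use le(2) in \<open>smt (verit) real_norm_def zero_le_power2\<close>)
  then have "integrable lborel01 (\<lambda>t. (\<phi> t - 1)\<^sup>2)"
    by (rule lborel01.integrable_const_bound) measurable
  ultimately show "J \<phi> = (\<integral>t. pot (\<phi> t) \<partial>lborel01)"
    by (simp add: J_def LBINT01 pot_def)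
qed

lemma G_eq_nn:
  assumes "has_weak_derivative \<phi> p"
  shows "G A \<phi> = enn2ereal (\<integral>\<^sup>+t. ennreal ((p t / \<phi> t)\<^sup>2) \<partial>lborel01) - ereal A"
proof -
  have "(\<integral>\<^sup>+t. ennreal ((weak_deriv \<phi> t / \<phi> t)\<^sup>2) \<partial>lborel01) = (\<integral>\<^sup>+t. ennreal ((p t / \<phi> t)\<^sup>2) \<partial>lborel01)"
    by (rule nn_integral_cong_AE) (use weak_deriv_AE[OF assms] in eventually_elim, auto)
  then show ?thesis by (simp add: G_def nn_integral01)
qed

lemma G_eq:
  assumes "has_weak_derivative \<phi> p" and L: "(\<lambda>t. p t / \<phi> t) \<in> L2"
  shows "G A \<phi> = ereal ((\<integral>t. (p t / \<phi> t)\<^sup>2 \<partial>lborel01) - A)"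
  unfolding G_eq_nn[OF assms(1)] by (subst nn_integral_eq_integral[OF L2D(2)[OF L]]) auto

text \<open>The benefit of an extended-real \<open>G\<close>: a finite value is a statement of
  square integrability, which the value of a Bochner integral would not give.\<close>

lemma G_bounded_imp_L2:
  assumes w: "has_weak_derivative \<phi> p" and G: "G A \<phi> \<le> ereal c"
  shows "(\<lambda>t. p t / \<phi> t) \<in> L2"
  unfolding L2_iff
proof
  have [measurable]: "\<phi> \<in> borel_measurable lborel01" "p \<in> borel_measurable lborel01"
    using w by (auto simp: has_weak_derivative_def intro: loc_integrable_measurable)
  show "(\<lambda>t. p t / \<phi> t) \<in> borel_measurable lborel01" by measurable
  have "(\<integral>\<^sup>+t. ennreal ((p t / \<phi> t)\<^sup>2) \<partial>lborel01) \<noteq> \<infinity>"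
    using G unfolding G_eq_nn[OF w] by auto
  then show "integrable lborel01 (\<lambda>t. (p t / \<phi> t)\<^sup>2)"
    by (intro integrableI_bounded) (auto simp: less_top)
qed

text \<open>Allows the Gateaux derivative to be found by integrating a pointwise quadratic
  remainder, instead of by differentiating under the integral sign.\<close>

lemma has_derivative_quadratic_error:
  fixes g :: "real \<Rightarrow> real"
  assumes "\<delta> > 0" and *: "\<And>\<epsilon>. \<bar>\<epsilon>\<bar> \<le> \<delta> \<Longrightarrow> \<bar>g \<epsilon> - g 0 - \<epsilon> * D\<bar> \<le> K * \<epsilon>\<^sup>2"
  shows "(g has_real_derivative D) (at 0)"
proof -
  have "((\<lambda>\<epsilon>. (g (0 + \<epsilon>) - g 0) / \<epsilon> - D) \<longlongrightarrow> 0) (at 0)"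
  proof (rule tendsto_norm_zero_cancel, rule tendsto_sandwich[of "\<lambda>_. 0" _ _ "\<lambda>\<epsilon>. K * \<bar>\<epsilon>\<bar>"])
    have "\<forall>\<^sub>F \<epsilon> in at 0. \<epsilon> \<noteq> 0 \<and> \<bar>\<epsilon>\<bar> \<le> \<delta>"
      using assms(1) by (auto simp: eventually_at intro!: exI[of _ \<delta>])
    then show "\<forall>\<^sub>F \<epsilon> in at 0. norm ((g (0 + \<epsilon>) - g 0) / \<epsilon> - D) \<le> K * \<bar>\<epsilon>\<bar>"
    proof eventually_elim
      case (elim \<epsilon>)
      have "(g (0 + \<epsilon>) - g 0) / \<epsilon> - D = (g \<epsilon> - g 0 - \<epsilon> * D) / \<epsilon>"
        using elim by (simp add: field_simps)
      then have "norm ((g (0 + \<epsilon>) - g 0) / \<epsilon> - D) = \<bar>g \<epsilon> - g 0 - \<epsilon> * D\<bar> / \<bar>\<epsilon>\<bar>" by simp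
      also have "\<dots> \<le> K * \<epsilon>\<^sup>2 / \<bar>\<epsilon>\<bar>"
        using * elim by (intro divide_right_mono) auto
      also have "\<dots> = K * \<bar>\<epsilon>\<bar>" using elim by (simp add: power2_eq_square abs_if)
      finally show ?case .
    qed
    have "((\<lambda>\<epsilon>::real. K * \<bar>\<epsilon>\<bar>) \<longlongrightarrow> K * \<bar>0\<bar>) (at 0)" by (intro tendsto_intros)
    then show "((\<lambda>\<epsilon>::real. K * \<bar>\<epsilon>\<bar>) \<longlongrightarrow> 0) (at 0)" by simp
  qed auto
  then show ?thesis unfolding DERIV_def by (simp add: LIM_zero_iff)
qed

text \<open>Since \<open>h' = w + q * h\<close>, the perturbed quotient is exactly q + \<epsilon> w
  / y with y = s + \<epsilon> h. The error thus comes only from replacing 1 / y by 1 / s and from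
  the square of w / y, and y \<ge> c / 2 controls both.\<close>

lemma quotient_square_taylor:
  fixes p s h h' \<epsilon> c B :: real
  assumes c: "0 < c" "c \<le> s" and B: "\<bar>h\<bar> \<le> B" and \<epsilon>: "\<bar>\<epsilon>\<bar> * B \<le> c / 2"
  defines "q \<equiv> p / s" and "w \<equiv> h' - p / s * h"
  shows "\<bar>((p + \<epsilon> * h') / (s + \<epsilon> * h))\<^sup>2 - q\<^sup>2 - \<epsilon> * (2 * q * w / s)\<bar>
           \<le> \<epsilon>\<^sup>2 * (2 * B / c\<^sup>2 * (q\<^sup>2 + w\<^sup>2) + 4 / c\<^sup>2 * w\<^sup>2)"
proof -
  define y where "y = s + \<epsilon> * h"
  have "\<bar>\<epsilon> * h\<bar> \<le> \<bar>\<epsilon>\<bar> * B" unfolding abs_mult using B by (intro mult_left_mono) auto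
  then have y: "c / 2 \<le> y" using \<epsilon> c unfolding y_def by linarith
  have pos: "s > 0" "y > 0" using c y by auto
  have "p = q * s" using pos by (simp add: q_def)
  then have "p + \<epsilon> * h' = q * y + \<epsilon> * w" by (simp add: y_def w_def q_def algebra_simps)
  then have v: "(p + \<epsilon> * h') / (s + \<epsilon> * h) = q + \<epsilon> * w / y"
    using pos by (simp add: y_def[symmetric] field_simps)
  have "1 / y - 1 / s = (s - y) / (s * y)" using pos by (simp add: divide_simps)
  then have inv: "1 / y - 1 / s = - (\<epsilon> * h / (s * y))" by (simp add: y_def)
  have "(q + \<epsilon> * w / y)\<^sup>2 - q\<^sup>2 - \<epsilon> * (2 * q * w / s) = \<epsilon> * (2 * q * w) * (1 / y - 1 / s) + \<epsilon>\<^sup>2 * (w / y)\<^sup>2"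
    by (simp add: power2_eq_square algebra_simps)
  also note inv
  finally have e: "((p + \<epsilon> * h') / (s + \<epsilon> * h))\<^sup>2 - q\<^sup>2 - \<epsilon> * (2 * q * w / s)
        = \<epsilon>\<^sup>2 * ((w / y)\<^sup>2 - 2 * q * w * (h / (s * y)))"
    unfolding v by (simp add: power2_eq_square algebra_simps)
  have sy: "c * (c / 2) \<le> s * y" using c y by (intro mult_mono) auto
  have 1: "\<bar>h / (s * y)\<bar> \<le> 2 * B / c\<^sup>2"
  proof -
    have "\<bar>h / (s * y)\<bar> = \<bar>h\<bar> / (s * y)" using pos by (simp add: abs_mult)
    also have "\<dots> \<le> B / (c * (c / 2))"
      using B sy c by (intro frac_le) auto
    finally show ?thesis by (simp add: power2_eq_square mult.commute)
  qed
  have 2: "\<bar>2 * q * w\<bar> \<le> q\<^sup>2 + w\<^sup>2"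
    using sum_squares_bound[of "\<bar>q\<bar>" "\<bar>w\<bar>"] by (simp add: abs_mult)
  have 3: "(w / y)\<^sup>2 \<le> 4 / c\<^sup>2 * w\<^sup>2"
  proof -
    have "(c / 2)\<^sup>2 \<le> y\<^sup>2" using y c by (intro power_mono) auto
    then have "w\<^sup>2 / y\<^sup>2 \<le> w\<^sup>2 / (c / 2)\<^sup>2" using c pos by (intro divide_left_mono) auto
    then show ?thesis by (simp add: power_divide mult.commute)
  qed
  have "\<bar>2 * q * w * (h / (s * y))\<bar> \<le> (q\<^sup>2 + w\<^sup>2) * (2 * B / c\<^sup>2)"
    unfolding abs_mult[of "2 * q * w"] by (intro mult_mono 1 2) auto
  with 3 have "\<bar>(w / y)\<^sup>2 - 2 * q * w * (h / (s * y))\<bar> \<le> 2 * B / c\<^sup>2 * (q\<^sup>2 + w\<^sup>2) + 4 / c\<^sup>2 * w\<^sup>2"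
    using zero_le_power2[of "w / y"] by (simp only: mult.commute[of "q\<^sup>2 + w\<^sup>2"])
  then show ?thesis unfolding e abs_mult by (simp add: mult_left_mono)
qed

text \<open>For small \<epsilon> the perturbed function stays above c / 2, so the integrand obeys a
  pointwise Taylor estimate with error at most \<epsilon>^2 times one integrable function
  \<open>M\<close>.\<close>

lemma gateaux_derivative_functional:
  fixes \<phi> p h h' :: "real \<Rightarrow> real"
  assumes c: "0 < c" "AE t in lborel01. c \<le> \<phi> t" and C: "AE t in lborel01. \<phi> t \<le> C"
    and \<phi>: "has_weak_derivative \<phi> p" "p \<in> L2"
    and B: "B > 0" "AE t in lborel01. \<bar>h t\<bar> \<le> B"
    and h: "has_weak_derivative h h'" "h' \<in> L2"
  shows "has_gateaux_derivative (\<lambda>\<xi>. ereal (J \<xi>) + ereal l * G A \<xi>) \<phi> h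
     (\<integral>t. dpot (\<phi> t) * h t + l * (2 * (p t / \<phi> t) * (h' t - p t / \<phi> t * h t) / \<phi> t) \<partial>lborel01)"
proof -
  have [measurable]: "\<phi> \<in> borel_measurable lborel01" "p \<in> borel_measurable lborel01"
      "h \<in> borel_measurable lborel01" "h' \<in> borel_measurable lborel01"
    using \<phi> h by (auto simp: has_weak_derivative_def intro: loc_integrable_measurable)
  define q where "q t = p t / \<phi> t" for t
  define w where "w t = h' t - p t / \<phi> t * h t" for t
  define v where "v \<epsilon> t = (p t + \<epsilon> * h' t) / (\<phi> t + \<epsilon> * h t)" for \<epsilon> t
  define d where "d t = dpot (\<phi> t) * h t + l * (2 * q t * w t / \<phi> t)" for t
  define e where "e \<epsilon> t = pot (\<phi> t + \<epsilon> * h t) + l * (v \<epsilon> t)\<^sup>2" for \<epsilon> t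
  \<comment> \<open>The largest size of \<epsilon> for which the bound on \<open>h\<close>
    guarantees |\<epsilon> h| \<le> c / 2.\<close>
  define \<delta> where "\<delta> = c / (2 * B)"
  have \<delta>: "\<delta> > 0" using c B by (simp add: \<delta>_def)
  have \<delta>B: "\<bar>\<epsilon>\<bar> * B \<le> c / 2" if "\<bar>\<epsilon>\<bar> \<le> \<delta>" for \<epsilon>
    using mult_right_mono[OF that, of B] B by (simp add: \<delta>_def)
  have [measurable]: "q \<in> borel_measurable lborel01" "w \<in> borel_measurable lborel01"
      "d \<in> borel_measurable lborel01" "v \<epsilon> \<in> borel_measurable lborel01" for \<epsilon>
    unfolding q_def[abs_def] w_def[abs_def] d_def[abs_def] v_def[abs_def] by measurable
  have inv: "AE t in lborel01. \<bar>1 / y t\<bar> \<le> 1 / k" if "0 < k" "AE t in lborel01. k \<le> y t" for k :: real and y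
    using that(2)
  proof eventually_elim
    case (elim t)
    have "1 / y t \<le> 1 / k" using elim that(1) by (intro frac_le) auto
    then show ?case using elim that(1) by simp
  qed
  have qL: "q \<in> L2"
    using L2_mult_bounded[OF \<phi>(2) _ inv[OF c]] by (simp add: q_def[abs_def])
  have wL: "w \<in> L2"
    using L2_diff[OF h(2) L2_mult_bounded[OF qL _ B(2)]] by (simp add: w_def[abs_def] q_def mult.commute)
  \<comment> \<open>The constant of \<open>pot_taylor\<close> for |\<phi>| \<le> C and increments of
    size at most c / 2.\<close>
  define K1 where "K1 = 6 * C\<^sup>2 + 1 + 4 * C * (c / 2) + (c / 2)\<^sup>2"
  define M where "M t = K1 * B\<^sup>2 + \<bar>l\<bar> * (2 * B / c\<^sup>2 * ((q t)\<^sup>2 + (w t)\<^sup>2) + 4 / c\<^sup>2 * (w t)\<^sup>2)" for t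
  have Mi: "integrable lborel01 M"
    unfolding M_def[abs_def] using L2D(2)[OF qL] L2D(2)[OF wL] by simp
  have di: "integrable lborel01 d"
  proof -
    have "(\<lambda>t. dpot (\<phi> t)) \<in> L2"
    proof (rule L2_bounded)
      show "AE t in lborel01. \<bar>dpot (\<phi> t)\<bar> \<le> 4 * C * (C\<^sup>2 + 1) + 2 * (C + 1)"
        using c(2) C
      proof eventually_elim
        case (elim t)
        have 1: "\<bar>\<phi> t\<bar> \<le> C" "0 \<le> C" using elim c(1) by auto
        have "\<bar>\<phi> t\<bar>\<^sup>2 \<le> C\<^sup>2" using 1 by (intro power_mono) auto
        then have 2: "\<bar>(\<phi> t)\<^sup>2 - 1\<bar> \<le> C\<^sup>2 + 1"
          using zero_le_power2[of "\<phi> t"] unfolding power2_abs by linarith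
        have "\<bar>\<phi> t * ((\<phi> t)\<^sup>2 - 1)\<bar> \<le> C * (C\<^sup>2 + 1)"
          unfolding abs_mult by (intro mult_mono 1 2) auto
        moreover have "\<bar>4 * x + 2 * (s - 1)\<bar> \<le> 4 * y + 2 * (C + 1)" if "\<bar>x\<bar> \<le> y" "\<bar>s\<bar> \<le> C" "0 \<le> C"
          for x y s :: real using that unfolding abs_le_iff by auto
        ultimately show ?case using 1 unfolding dpot_def by (simp only: mult.assoc)
      qed
    qed measurable
    moreover have "h \<in> L2" using B by (intro L2_bounded) auto
    moreover have "(\<lambda>t. 1 / \<phi> t * q t) \<in> L2" by (rule L2_mult_bounded[OF qL _ inv[OF c]]) measurable
    ultimately have "integrable lborel01 (\<lambda>t. dpot (\<phi> t) * h t + l * (2 * (1 / \<phi> t * q t * w t)))"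
      using wL by (intro Bochner_Integration.integrable_add integrable_mult_right L2_mult) auto
    then show ?thesis by (simp add: d_def[abs_def] mult_ac)
  qed
  have pointwise: "AE t in lborel01. \<bar>e \<epsilon> t - e 0 t - \<epsilon> * d t\<bar> \<le> \<epsilon>\<^sup>2 * M t" if \<epsilon>: "\<bar>\<epsilon>\<bar> \<le> \<delta>" for \<epsilon>
    using c(2) C B(2)
  proof eventually_elim
    case (elim t)
    have "\<bar>\<epsilon> * h t\<bar> \<le> \<bar>\<epsilon>\<bar> * B" unfolding abs_mult using elim by (intro mult_left_mono) auto
    then have eh: "\<bar>\<epsilon> * h t\<bar> \<le> c / 2" using \<delta>B[OF \<epsilon>] by linarith
    have K1: "0 \<le> K1" unfolding K1_def using c elim by simp
    have "\<bar>pot (\<phi> t + \<epsilon> * h t) - pot (\<phi> t) - \<epsilon> * h t * dpot (\<phi> t)\<bar> \<le> K1 * (\<epsilon> * h t)\<^sup>2"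
      unfolding K1_def using elim c eh by (intro pot_taylor) auto
    also have "\<dots> \<le> K1 * (\<epsilon>\<^sup>2 * B\<^sup>2)"
    proof -
      have "\<bar>h t\<bar>\<^sup>2 \<le> B\<^sup>2" using elim by (intro power_mono) auto
      then show ?thesis using K1 by (simp add: power_mult_distrib mult_left_mono)
    qed
    finally have 1: "\<bar>pot (\<phi> t + \<epsilon> * h t) - pot (\<phi> t) - \<epsilon> * h t * dpot (\<phi> t)\<bar> \<le> \<epsilon>\<^sup>2 * (K1 * B\<^sup>2)"
      by (simp add: mult_ac)
    define E where "E = (v \<epsilon> t)\<^sup>2 - (q t)\<^sup>2 - \<epsilon> * (2 * q t * w t / \<phi> t)"
    have "\<bar>E\<bar> \<le> \<epsilon>\<^sup>2 * (2 * B / c\<^sup>2 * ((q t)\<^sup>2 + (w t)\<^sup>2) + 4 / c\<^sup>2 * (w t)\<^sup>2)"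
      unfolding E_def v_def q_def w_def by (rule quotient_square_taylor[OF c(1) elim(1,3) \<delta>B[OF \<epsilon>]])
    then have 2: "\<bar>l * E\<bar> \<le> \<epsilon>\<^sup>2 * (\<bar>l\<bar> * (2 * B / c\<^sup>2 * ((q t)\<^sup>2 + (w t)\<^sup>2) + 4 / c\<^sup>2 * (w t)\<^sup>2))"
      using mult_left_mono[of "\<bar>E\<bar>" _ "\<bar>l\<bar>"] by (simp add: abs_mult mult.left_commute)
    have "v 0 t = q t" by (simp add: v_def q_def)
    then have "e \<epsilon> t - e 0 t - \<epsilon> * d t = (pot (\<phi> t + \<epsilon> * h t) - pot (\<phi> t) - \<epsilon> * h t * dpot (\<phi> t)) + l * E"
      unfolding e_def d_def E_def by (simp add: algebra_simps)
    also have "\<bar>\<dots>\<bar> \<le> \<epsilon>\<^sup>2 * (K1 * B\<^sup>2) + \<epsilon>\<^sup>2 * (\<bar>l\<bar> * (2 * B / c\<^sup>2 * ((q t)\<^sup>2 + (w t)\<^sup>2) + 4 / c\<^sup>2 * (w t)\<^sup>2))"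
      using 1 2 by linarith
    also have "\<dots> = \<epsilon>\<^sup>2 * M t" unfolding M_def by (simp only: distrib_left)
    finally show ?case .
  qed
  let ?F = "\<lambda>\<epsilon>. ereal (J (\<lambda>t. \<phi> t + \<epsilon> * h t)) + ereal l * G A (\<lambda>t. \<phi> t + \<epsilon> * h t)"
  have F: "?F \<epsilon> = ereal ((\<integral>t. e \<epsilon> t \<partial>lborel01) - l * A)" "integrable lborel01 (e \<epsilon>)"
    if \<epsilon>: "\<bar>\<epsilon>\<bar> \<le> \<delta>" for \<epsilon>
  proof -
    have y: "AE t in lborel01. c / 2 \<le> \<phi> t + \<epsilon> * h t \<and> \<bar>\<phi> t + \<epsilon> * h t\<bar> \<le> C + c"
      using c(2) C B(2)
    proof eventually_elim
      case (elim t)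
      have "\<bar>\<epsilon> * h t\<bar> \<le> \<bar>\<epsilon>\<bar> * B" unfolding abs_mult using elim by (intro mult_left_mono) auto
      then have "\<bar>\<epsilon> * h t\<bar> \<le> c / 2" using \<delta>B[OF \<epsilon>] by linarith
      then show ?case using elim c(1) by linarith
    qed
    have J: "integrable lborel01 (\<lambda>t. pot (\<phi> t + \<epsilon> * h t))"
        "J (\<lambda>t. \<phi> t + \<epsilon> * h t) = (\<integral>t. pot (\<phi> t + \<epsilon> * h t) \<partial>lborel01)"
      by (intro J_eq[where C="C + c"]; use y in auto)+
    have vL: "v \<epsilon> \<in> L2"
    proof -
      have "AE t in lborel01. \<bar>1 / (\<phi> t + \<epsilon> * h t)\<bar> \<le> 1 / (c / 2)"
        by (rule inv) (use c(1) y in auto)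
      from L2_mult_bounded[OF L2_add[OF \<phi>(2) L2_cmult[OF h(2), of \<epsilon>]] _ this]
      show ?thesis by (simp add: v_def[abs_def])
    qed
    have "G A (\<lambda>t. \<phi> t + \<epsilon> * h t) = ereal ((\<integral>t. (v \<epsilon> t)\<^sup>2 \<partial>lborel01) - A)"
      unfolding v_def by (rule G_eq[OF has_weak_derivative_lincomb[OF \<phi>(1) h(1)]])
        (use vL in \<open>simp add: v_def[abs_def]\<close>)
    moreover show "integrable lborel01 (e \<epsilon>)"
      unfolding e_def[abs_def] using J(1) L2D(2)[OF vL] by simp
    moreover have "(\<integral>t. e \<epsilon> t \<partial>lborel01) = (\<integral>t. pot (\<phi> t + \<epsilon> * h t) \<partial>lborel01) + l * (\<integral>t. (v \<epsilon> t)\<^sup>2 \<partial>lborel01)"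
      unfolding e_def using J(1) L2D(2)[OF vL] by simp
    ultimately show "?F \<epsilon> = ereal ((\<integral>t. e \<epsilon> t \<partial>lborel01) - l * A)"
      using J(2) by (simp add: algebra_simps)
  qed
  let ?g = "\<lambda>\<epsilon>. real_of_ereal (?F \<epsilon>)"
  have "(?g has_real_derivative (\<integral>t. d t \<partial>lborel01)) (at 0)"
  proof (rule has_derivative_quadratic_error[OF \<delta>])
    fix \<epsilon> assume \<epsilon>: "\<bar>\<epsilon>\<bar> \<le> \<delta>"
    have z: "\<bar>0\<bar> \<le> \<delta>" using \<delta> by simp
    have "?g \<epsilon> - ?g 0 - \<epsilon> * (\<integral>t. d t \<partial>lborel01) = (\<integral>t. e \<epsilon> t \<partial>lborel01) - (\<integral>t. e 0 t \<partial>lborel01) - \<epsilon> * (\<integral>t. d t \<partial>lborel01)"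
      unfolding F(1)[OF \<epsilon>] F(1)[OF z] by simp
    also have "\<dots> = (\<integral>t. e \<epsilon> t - e 0 t - \<epsilon> * d t \<partial>lborel01)"
      using F(2)[OF \<epsilon>] F(2)[OF z] di by simp
    finally have "\<bar>?g \<epsilon> - ?g 0 - \<epsilon> * (\<integral>t. d t \<partial>lborel01)\<bar> = \<bar>\<integral>t. e \<epsilon> t - e 0 t - \<epsilon> * d t \<partial>lborel01\<bar>"
      by (rule arg_cong)
    also have "\<dots> \<le> (\<integral>t. \<bar>e \<epsilon> t - e 0 t - \<epsilon> * d t\<bar> \<partial>lborel01)"
      by (rule integral_abs_bound)
    also have "\<dots> \<le> (\<integral>t. \<epsilon>\<^sup>2 * M t \<partial>lborel01)"
      by (rule integral_mono_AE) (use F(2)[OF \<epsilon>] F(2)[OF z] di Mi pointwise[OF \<epsilon>] in auto)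
    finally have "\<bar>?g \<epsilon> - ?g 0 - \<epsilon> * (\<integral>t. d t \<partial>lborel01)\<bar> \<le> (\<integral>t. \<epsilon>\<^sup>2 * M t \<partial>lborel01)" .
    then show "\<bar>?g \<epsilon> - ?g 0 - \<epsilon> * (\<integral>t. d t \<partial>lborel01)\<bar> \<le> (\<integral>t. M t \<partial>lborel01) * \<epsilon>\<^sup>2"
      by (simp add: mult.commute)
  qed
  moreover have "\<forall>\<^sub>F \<epsilon> in nhds 0. \<bar>?F \<epsilon>\<bar> \<noteq> \<infinity>"
    unfolding eventually_nhds_metric
  proof (intro exI conjI allI impI)
    fix \<epsilon> :: real assume "dist \<epsilon> 0 < \<delta>"
    then show "\<bar>?F \<epsilon>\<bar> \<noteq> \<infinity>" using F(1)[of \<epsilon>] by (simp del: plus_ereal.simps times_ereal.simps)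
  qed fact
  ultimately show ?thesis
    unfolding has_gateaux_derivative_def d_def q_def w_def by simp
qed

text \<open>A continuous \<open>g\<close> is bounded on [0,1], and squaring the integral of the
  difference lets \<open>integral01_square_le\<close> serve in place of the Cauchy-Schwarz
  inequality.\<close>

lemma integral01_L2_limit:
  assumes f: "\<And>n. f n \<in> L2" "k \<in> L2" and g: "continuous_on {0..1} g"
    and lim: "(\<lambda>n. \<integral>t. (f n t - k t)\<^sup>2 \<partial>lborel01) \<longlonglongrightarrow> 0"
  shows "(\<lambda>n. \<integral>t. g t * f n t \<partial>lborel01) \<longlonglongrightarrow> (\<integral>t. g t * k t \<partial>lborel01)"
proof -
  obtain K where K: "\<And>t. t \<in> {0..1} \<Longrightarrow> \<bar>g t\<bar> \<le> K" using bounded01_continuous[OF g] by metis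
  have gm: "g \<in> borel_measurable lborel01" using L2D(1)[OF L2_continuous[OF g]] .
  have ae: "AE t in lborel01. \<bar>g t\<bar> \<le> K" by (rule AE01I) (simp add: K)
  have dL: "(\<lambda>t. f n t - k t) \<in> L2" for n by (rule L2_diff[OF f])
  have "(\<lambda>n. \<integral>t. g t * (f n t - k t) \<partial>lborel01) \<longlonglongrightarrow> 0"
  proof -
    have "(\<lambda>n. (\<integral>t. g t * (f n t - k t) \<partial>lborel01)\<^sup>2) \<longlonglongrightarrow> 0"
    proof (rule tendsto_sandwich[OF _ _ tendsto_const])
      show "\<forall>\<^sub>F n in sequentially. (\<integral>t. g t * (f n t - k t) \<partial>lborel01)\<^sup>2 \<le> K\<^sup>2 * (\<integral>t. (f n t - k t)\<^sup>2 \<partial>lborel01)"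
      proof (intro always_eventually allI)
        fix n
        have L: "(\<lambda>t. g t * (f n t - k t)) \<in> L2" by (rule L2_mult_bounded[OF dL gm ae])
        have "(\<integral>t. g t * (f n t - k t) \<partial>lborel01)\<^sup>2 \<le> (\<integral>t. (g t * (f n t - k t))\<^sup>2 \<partial>lborel01)"
          by (rule integral01_square_le[OF L])
        also have "\<dots> \<le> (\<integral>t. K\<^sup>2 * (f n t - k t)\<^sup>2 \<partial>lborel01)"
        proof (rule integral_mono_AE)
          show "AE t in lborel01. (g t * (f n t - k t))\<^sup>2 \<le> K\<^sup>2 * (f n t - k t)\<^sup>2"
            using ae
          proof eventually_elim
            case (elim t)
            then have "\<bar>g t\<bar>\<^sup>2 \<le> K\<^sup>2" by (intro power_mono) auto
            then show ?case unfolding power_mult_distrib power2_abs by (rule mult_right_mono) simp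
          qed
        qed (rule L2D(2)[OF L], rule integrable_mult_right, rule L2D(2)[OF dL])
        also have "\<dots> = K\<^sup>2 * (\<integral>t. (f n t - k t)\<^sup>2 \<partial>lborel01)" by simp
        finally show "(\<integral>t. g t * (f n t - k t) \<partial>lborel01)\<^sup>2 \<le> K\<^sup>2 * (\<integral>t. (f n t - k t)\<^sup>2 \<partial>lborel01)" .
      qed
      show "(\<lambda>n. K\<^sup>2 * (\<integral>t. (f n t - k t)\<^sup>2 \<partial>lborel01)) \<longlonglongrightarrow> 0"
        using tendsto_mult_right[OF lim, of "K\<^sup>2"] by (simp add: mult.commute tendsto_mult_right_zero lim)
    qed simp
    from tendsto_real_sqrt[OF this] show ?thesis by (simp add: tendsto_rabs_zero_iff)
  qed
  moreover have "(\<integral>t. g t * (f n t - k t) \<partial>lborel01) = (\<integral>t. g t * f n t \<partial>lborel01) - (\<integral>t. g t * k t \<partial>lborel01)" for n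
    using L2_mult[OF L2_continuous[OF g]] f by (simp add: right_diff_distrib)
  ultimately show ?thesis by (simp add: LIM_zero_iff)
qed

text \<open>For test functions this is the definition of \<open>a\<close> as the weak derivative of
  \<open>b\<close>. Continuity of \<open>a\<close> and \<open>b\<close> up to the boundary lets both
  integrals pass to the limit along an approximating sequence of \<open>h\<close>.\<close>

lemma W012_orthogonal:
  assumes a: "continuous_on {0..1} a" and b: "continuous_on {0..1} b"
    and ba: "\<And>t. t \<in> {0<..<1} \<Longrightarrow> (b has_real_derivative a t) (at t)"
    and h: "h \<in> W012"
  shows "(\<integral>t. a t * h t + b t * weak_deriv h t \<partial>lborel01) = 0"
proof (rule W012_approx[OF h])
  fix \<eta> :: "nat \<Rightarrow> real \<Rightarrow> real" assume \<eta>: "\<And>n. \<eta> n \<in> test_fun"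
    and lim: "(\<lambda>n. \<integral>t. (\<eta> n t - h t)\<^sup>2 \<partial>lborel01) \<longlonglongrightarrow> 0"
      "(\<lambda>n. \<integral>t. (deriv (\<eta> n) t - weak_deriv h t)\<^sup>2 \<partial>lborel01) \<longlonglongrightarrow> 0"
  have hW: "h \<in> W12" using h by (simp add: W012_def)
  have "(\<lambda>n. (\<integral>t. a t * \<eta> n t \<partial>lborel01) + (\<integral>t. b t * deriv (\<eta> n) t \<partial>lborel01))
      \<longlonglongrightarrow> (\<integral>t. a t * h t \<partial>lborel01) + (\<integral>t. b t * weak_deriv h t \<partial>lborel01)"
    by (intro tendsto_add integral01_L2_limit a b lim test_fun_L2 \<eta> W12_D hW)
  moreover have "has_weak_derivative b a"
    using ba a by (intro has_weak_derivative_C1) (auto intro: continuous_on_subset)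
  then have "(\<integral>t. a t * \<eta> n t \<partial>lborel01) + (\<integral>t. b t * deriv (\<eta> n) t \<partial>lborel01) = 0" for n
    using \<eta> by (simp add: has_weak_derivative01)
  ultimately have "(\<integral>t. a t * h t \<partial>lborel01) + (\<integral>t. b t * weak_deriv h t \<partial>lborel01) = 0"
    by (simp add: LIMSEQ_const_iff)
  then show ?thesis
    using L2_mult[OF L2_continuous[OF a] W12_D(1)[OF hW]] L2_mult[OF L2_continuous[OF b] W12_D(2)[OF hW]] by simp
qed

section \<open>Minimality of solutions of the first-order equation\<close>

text \<open>\<open>dpot s * s\<close> is the derivative of \<open>pot \<circ> exp\<close> at
  \<open>ln s\<close>, so this is strict convexity of \<open>pot \<circ> exp\<close> on the
  nonnegative axis. Monotonicity fails near s = 0, where the derivative of \<open>dpot s * s\<close>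
  is close to -2. The difference of the two sides factors through w - s.\<close>

lemma slope_strict_mono:
  assumes "1 \<le> s" "s < (w::real)"
  shows "dpot s * s < dpot w * w"
proof -
  have "w * w > 1 * 1" using assms by (intro mult_strict_mono) auto
  then have w2: "w\<^sup>2 > 1" by (simp add: power2_eq_square)
  have "1 * 1 \<le> s * s" using assms by (intro mult_mono) auto
  then have s2: "s\<^sup>2 \<ge> 1" by (simp add: power2_eq_square)
  have "2 \<le> w\<^sup>2 + s\<^sup>2" using w2 s2 by linarith
  then have "(w + s) * 2 \<le> (w + s) * (w\<^sup>2 + s\<^sup>2)" using assms by (intro mult_left_mono) auto
  moreover have "0 < 4 * x - 2 * (w + s) - 2" if "(w + s) * 2 \<le> x" for x
    using assms that by argo
  ultimately have "0 < 4 * ((w + s) * (w\<^sup>2 + s\<^sup>2)) - 2 * (w + s) - 2" by blast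
  then have "0 < (w - s) * (4 * ((w + s) * (w\<^sup>2 + s\<^sup>2)) - 2 * (w + s) - 2)"
    using assms by (intro mult_pos_pos) auto
  also have "\<dots> = dpot w * w - dpot s * s"
    by (simp add: dpot_def power2_eq_square algebra_simps)
  finally show ?thesis by simp
qed

lemma pot_exp_strict_convex:
  assumes "0 \<le> x" "0 \<le> y" "x \<noteq> y"
  shows "pot (exp x) + dpot (exp x) * exp x * (y - x) < pot (exp y)"
proof -
  have d: "((\<lambda>x. pot (exp x)) has_real_derivative dpot (exp x) * exp x) (at x)" for x
    using DERIV_chain2[OF pot_has_derivative DERIV_exp] .
  show ?thesis
  proof (cases "x < y")
    case True
    then obtain z where z: "x < z" "pot (exp y) - pot (exp x) = (y - x) * (dpot (exp z) * exp z)"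
      using MVT2[OF True, of "\<lambda>x. pot (exp x)" "\<lambda>x. dpot (exp x) * exp x"] d by blast
    have "(y - x) * (dpot (exp x) * exp x) < (y - x) * (dpot (exp z) * exp z)"
      using True z assms by (intro mult_strict_left_mono slope_strict_mono) auto
    then show ?thesis using z(2) by (simp add: mult_ac)
  next
    case False
    then have yx: "y < x" using assms by simp
    then obtain z where z: "y < z" "z < x" "pot (exp x) - pot (exp y) = (x - y) * (dpot (exp z) * exp z)"
      using MVT2[OF yx, of "\<lambda>x. pot (exp x)" "\<lambda>x. dpot (exp x) * exp x"] d by blast
    have "(x - y) * (dpot (exp z) * exp z) < (x - y) * (dpot (exp x) * exp x)"
      using yx z assms by (intro mult_strict_left_mono slope_strict_mono) auto
    then show ?thesis using z(3) by (simp add: algebra_simps)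
  qed
qed

text \<open>Tangent inequality in logarithmic coordinates. Its equality case later turns equality of
  the values of \<open>J\<close> into equality of functions.\<close>

lemma pot_log_convex:
  assumes "1 \<le> s" "1 \<le> w"
  shows "pot s + dpot s * s * (ln w - ln s) \<le> pot w"
    and "pot s + dpot s * s * (ln w - ln s) = pot w \<Longrightarrow> w = s"
proof -
  have s: "exp (ln s) = s" "exp (ln w) = w" "0 \<le> ln s" "0 \<le> ln w" using assms by auto
  have "pot s + dpot s * s * (ln w - ln s) < pot w" if "w \<noteq> s"
    using pot_exp_strict_convex[of "ln s" "ln w"] s that by force
  then show "pot s + dpot s * s * (ln w - ln s) \<le> pot w"
    and "pot s + dpot s * s * (ln w - ln s) = pot w \<Longrightarrow> w = s"
    by (cases "w = s"; force)+
qed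

text \<open>Meeting point of both directions: critical points are shown to satisfy these conditions,
  and solutions of the multiplier system produce functions that do. The equation is imposed on the
  open interval only, because a critical point is smooth only there.\<close>

locale trajectory =
  fixes R l m :: real and \<phi> :: "real \<Rightarrow> real"
  assumes R: "R > 1" and l: "l > 0" and m: "m > 0"
    and cont: "continuous_on {0..1} \<phi>" and \<phi>0: "\<phi> 0 = 1" and \<phi>1: "\<phi> 1 = R"
    and pos: "\<And>t. t \<in> {0..1} \<Longrightarrow> \<phi> t > 0"
    and ode: "\<And>t. t \<in> {0<..<1} \<Longrightarrow>
      (\<phi> has_real_derivative \<phi> t * (sqrt (m + pot (\<phi> t)) / sqrt l)) (at t)"
begin

text \<open>The derivative u' of u = ln \<phi>, in a form that is continuous up to the end
  points.\<close>

definition rate :: "real \<Rightarrow> real" where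
  "rate t = sqrt (m + pot (\<phi> t)) / sqrt l"

lemmas radicand_pos = add_pot_pos[OF m]

lemma rate_pos: "rate t > 0"
  using radicand_pos l by (simp add: rate_def)

lemma rate_square: "(rate t)\<^sup>2 = (m + pot (\<phi> t)) / l"
  using radicand_pos[of "\<phi> t"] l by (simp add: rate_def power_divide)

lemma continuous_rate: "continuous_on {0..1} rate"
  unfolding rate_def[abs_def] using l by (intro continuous_intros cont) auto

lemma \<phi>_deriv: "t \<in> {0<..<1} \<Longrightarrow> (\<phi> has_real_derivative \<phi> t * rate t) (at t)"
  using ode by (simp add: rate_def)

text \<open>Differentiating the first integral l u'^2 = m + \<open>pot \<phi>\<close> and cancelling
  u' > 0 gives back the second-order Euler-Lagrange equation for u.\<close>

lemma rate_deriv: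
  assumes t: "t \<in> {0<..<1}"
  shows "(rate has_real_derivative dpot (\<phi> t) * \<phi> t / (2 * l)) (at t)"
proof -
  have "((\<lambda>t. m + pot (\<phi> t)) has_real_derivative dpot (\<phi> t) * (\<phi> t * rate t)) (at t)"
    using DERIV_add[OF DERIV_const[of m] DERIV_chain2[OF pot_has_derivative \<phi>_deriv[OF t]]] by simp
  from DERIV_chain2[OF DERIV_real_sqrt[OF radicand_pos] this]
  have "(rate has_real_derivative inverse (sqrt (m + pot (\<phi> t))) / 2 * (dpot (\<phi> t) * (\<phi> t * rate t)) / sqrt l) (at t)"
    unfolding rate_def[abs_def] by (rule DERIV_cdivide)
  moreover have "inverse (sqrt (m + pot (\<phi> t))) * rate t / sqrt l = 1 / l"
    using radicand_pos[of "\<phi> t"] l by (simp add: rate_def field_simps)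
  moreover have "inverse (sqrt (m + pot (\<phi> t))) / 2 * (dpot (\<phi> t) * (\<phi> t * rate t)) / sqrt l
      = dpot (\<phi> t) * \<phi> t / 2 * (inverse (sqrt (m + pot (\<phi> t))) * rate t / sqrt l)"
    by simp
  ultimately show ?thesis by simp
qed

lemma strict_mono: "strict_mono_on {0..1} \<phi>"
proof (rule strict_mono_onI)
  fix s t :: real assume st: "s \<in> {0..1}" "t \<in> {0..1}" "s < t"
  show "\<phi> s < \<phi> t"
  proof (rule DERIV_pos_imp_increasing_open[OF st(3)])
    fix x assume x: "s < x" "x < t"
    then have "x \<in> {0<..<1}" using st by auto
    then show "\<exists>y. (\<phi> has_real_derivative y) (at x) \<and> 0 < y"
      using \<phi>_deriv pos[of x] rate_pos by (intro exI[of _ "\<phi> x * rate x"]) auto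
  qed (use st in \<open>auto intro: continuous_on_subset[OF cont]\<close>)
qed

lemma ge1: "t \<in> {0..1} \<Longrightarrow> 1 \<le> \<phi> t"
  using strict_mono_onD[OF strict_mono, of 0 t] \<phi>0 by (cases "t = 0") auto

lemma leR: "t \<in> {0..1} \<Longrightarrow> \<phi> t \<le> R"
  using strict_mono_onD[OF strict_mono, of t 1] \<phi>1 by (cases "t = 1") auto

lemma C2: "\<phi> \<in> C2_on {0<..<1}"
proof -
  have c: "continuous_on {0<..<1} \<phi>" "continuous_on {0<..<1} rate"
    using cont continuous_rate by (auto intro: continuous_on_subset)
  have d: "deriv \<phi> t = \<phi> t * rate t" if "t \<in> {0<..<1}" for t
    using \<phi>_deriv[OF that] by (rule DERIV_imp_deriv)
  have "(deriv \<phi> has_real_derivative \<phi> t * rate t * rate t + dpot (\<phi> t) * \<phi> t / (2 * l) * \<phi> t) (at t)"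
    if t: "t \<in> {0<..<1}" for t
    by (rule has_field_derivative_transform_within_open[OF DERIV_mult[OF \<phi>_deriv[OF t] rate_deriv[OF t]], of "{0<..<1}"])
       (use t d in auto)
  then have "deriv \<phi> C1_differentiable_on {0<..<1}"
    by (rule C1_differentiable_onI) (use c l in \<open>auto intro!: continuous_intros\<close>)
  moreover have "\<phi> C1_differentiable_on {0<..<1}"
    by (rule C1_differentiable_onI[OF \<phi>_deriv]) (use c in \<open>auto intro!: continuous_intros\<close>)
  ultimately show ?thesis by (simp add: C2_on_def)
qed

lemma weak: "has_weak_derivative \<phi> (\<lambda>t. \<phi> t * rate t)"
  by (rule has_weak_derivative_C1[OF \<phi>_deriv])
     (auto intro!: continuous_intros continuous_on_subset[OF cont] continuous_on_subset[OF continuous_rate])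

lemma weak_L2: "(\<lambda>t. \<phi> t * rate t) \<in> L2"
  by (intro L2_continuous continuous_intros cont continuous_rate)

lemma in_Q12: "\<phi> \<in> Q12 R"
  using weak weak_L2 L2_continuous[OF cont] cont \<phi>0 \<phi>1 by (auto simp: Q12_def W12_def)

lemma in_Q_plus: "\<phi> \<in> Q_plus R"
  using C2 cont \<phi>0 \<phi>1 strict_mono by (simp add: Q_plus_def)

lemma G_eq_rate: "G A \<phi> = ereal ((\<integral>t. (rate t)\<^sup>2 \<partial>lborel01) - A)"
proof -
  have eq: "(\<integral>t. (\<phi> t * rate t / \<phi> t)\<^sup>2 \<partial>lborel01) = (\<integral>t. (rate t)\<^sup>2 \<partial>lborel01)"
    by (rule Bochner_Integration.integral_cong) (use pos in \<open>auto simp: less_le\<close>)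
  have "continuous_on {0..1} (\<lambda>t. \<phi> t * rate t / \<phi> t)"
    using pos by (intro continuous_intros cont continuous_rate) force
  from G_eq[OF weak L2_continuous[OF this]] show ?thesis by (simp only: eq)
qed

lemma J_eq_pot: "J \<phi> = (\<integral>t. pot (\<phi> t) \<partial>lborel01)"
proof (rule J_eq(2)[where C=R])
  show "AE t in lborel01. \<bar>\<phi> t\<bar> \<le> R"
  proof (rule AE01I)
    fix t :: real assume "t \<in> {0<..<1}"
    then show "\<bar>\<phi> t\<bar> \<le> R" using ge1[of t] leR[of t] by auto
  qed
qed (rule L2D(1)[OF L2_continuous[OF cont]])

text \<open>The first variation has the form of an integral of a h + b h' with b = 2 l \<phi>' /
  \<phi>^2, and \<open>rate_deriv\<close> says precisely that b' = a.\<close>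

lemma critical: "critical_point (\<lambda>\<xi>. ereal (J \<xi>) + ereal l * G A \<xi>) W012 \<phi>"
  unfolding critical_point_def
proof
  fix h assume h: "h \<in> W012"
  then have hW: "h \<in> W12" by (simp add: W012_def)
  obtain B where B: "B > 0" "AE t in lborel01. \<bar>h t\<bar> \<le> B" by (rule W012_bounded[OF h])
  let ?h' = "weak_deriv h"
  let ?p = "\<lambda>t. \<phi> t * rate t"
  let ?a = "\<lambda>t. dpot (\<phi> t) - 2 * l * (rate t)\<^sup>2 / \<phi> t" and ?b = "\<lambda>t. 2 * l * rate t / \<phi> t"
  have "has_gateaux_derivative (\<lambda>\<xi>. ereal (J \<xi>) + ereal l * G A \<xi>) \<phi> h
     (\<integral>t. dpot (\<phi> t) * h t + l * (2 * (?p t / \<phi> t) * (?h' t - ?p t / \<phi> t * h t) / \<phi> t) \<partial>lborel01)"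
    by (rule gateaux_derivative_functional[OF _ _ _ weak weak_L2 B W12_D(3)[OF hW] W12_D(2)[OF hW], of 1 R])
       (auto intro!: AE01I ge1 leR)
  also have "(\<integral>t. dpot (\<phi> t) * h t + l * (2 * (?p t / \<phi> t) * (?h' t - ?p t / \<phi> t * h t) / \<phi> t) \<partial>lborel01)
      = (\<integral>t. ?a t * h t + ?b t * ?h' t \<partial>lborel01)"
  proof (rule Bochner_Integration.integral_cong)
    fix t assume "t \<in> space lborel01"
    then have "\<phi> t > 0" using pos[of t] by simp
    then show "dpot (\<phi> t) * h t + l * (2 * (?p t / \<phi> t) * (?h' t - ?p t / \<phi> t * h t) / \<phi> t) = ?a t * h t + ?b t * ?h' t"
      by (simp add: divide_simps) (simp add: power2_eq_square algebra_simps)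
  qed simp
  also have "(\<integral>t. ?a t * h t + ?b t * ?h' t \<partial>lborel01) = 0"
  proof (rule W012_orthogonal[OF _ _ _ h])
    show "continuous_on {0..1} ?a" "continuous_on {0..1} ?b"
      using pos by (intro continuous_intros cont continuous_rate; force)+
    fix t :: real assume t: "t \<in> {0<..<1}"
    then have p: "\<phi> t > 0" using pos[of t] by simp
    have "((\<lambda>t. 2 * l * rate t / \<phi> t) has_real_derivative
       ((2 * l * (dpot (\<phi> t) * \<phi> t / (2 * l))) * \<phi> t - 2 * l * rate t * (\<phi> t * rate t)) / (\<phi> t * \<phi> t)) (at t)"
      using p by (intro DERIV_divide DERIV_cmult rate_deriv \<phi>_deriv t) auto
    moreover have "((2 * l * (dpot (\<phi> t) * \<phi> t / (2 * l))) * \<phi> t - 2 * l * rate t * (\<phi> t * rate t)) / (\<phi> t * \<phi> t) = ?a t"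
      using p l by (simp add: divide_simps) (simp add: power2_eq_square algebra_simps)
    ultimately show "(?b has_real_derivative ?a t) (at t)" by simp
  qed
  finally show "has_gateaux_derivative (\<lambda>\<xi>. ereal (J \<xi>) + ereal l * G A \<xi>) \<phi> h 0" .
qed

text \<open>\<open>K\<close> = 2 l u' (ln v - ln \<phi>) vanishes at both ends, and its derivative
  is \<open>X + Y\<close>: \<open>X\<close> is the tangent term of \<open>pot \<circ> exp\<close>,
  \<open>Y\<close> that of l u'^2. The constraint makes the integral of \<open>Y\<close>
  nonpositive, hence that of \<open>X\<close> nonnegative. So \<open>J v - J \<phi>\<close>
  dominates the integral of the convexity gap \<open>Z\<close>, which is nonnegative, and equality
  of the two values forces \<open>Z\<close> to vanish.\<close>

lemma minimal:
  assumes A: "(\<integral>t. (rate t)\<^sup>2 \<partial>lborel01) = A"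
    and v: "v \<in> Q_plus R" and G: "G A v \<le> 0"
  shows "J \<phi> \<le> J v" and "J v \<le> J \<phi> \<Longrightarrow> t \<in> {0..1} \<Longrightarrow> v t = \<phi> t"
proof -
  have vc: "continuous_on {0..1} v" and v01: "v 0 = 1" "v 1 = R" and vm: "strict_mono_on {0..1} v"
    and v1: "v C1_differentiable_on {0<..<1}"
    using v by (auto simp: Q_plus_def C2_on_def)
  note dv = C1_differentiable_onD[OF v1]
  have v_ge: "1 \<le> v t" if "t \<in> {0..1}" for t
    using strict_mono_onD[OF vm, of 0 t] v01 that by (cases "t = 0") auto
  have v_le: "v t \<le> R" if "t \<in> {0..1}" for t
    using strict_mono_onD[OF vm, of t 1] v01 that by (cases "t = 1") auto
  have vw: "has_weak_derivative v (deriv v)" by (rule has_weak_derivative_C1[OF dv])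
  define q where "q t = deriv v t / v t" for t
  have qL: "q \<in> L2" using G_bounded_imp_L2[OF vw, of A 0] G by (simp add: q_def[abs_def] zero_ereal_def)
  have qA: "(\<integral>t. (q t)\<^sup>2 \<partial>lborel01) \<le> A"
    using G G_eq[OF vw, of A] qL by (simp add: q_def[abs_def] zero_ereal_def)
  define K where "K t = 2 * l * rate t * (ln (v t) - ln (\<phi> t))" for t
  define X where "X t = dpot (\<phi> t) * \<phi> t * (ln (v t) - ln (\<phi> t))" for t
  define Y where "Y t = 2 * l * (rate t * (q t - rate t))" for t
  have logc: "continuous_on {0..1} (\<lambda>t. ln (v t) - ln (\<phi> t))"
    using v_ge pos by (intro continuous_intros vc cont) (force dest: v_ge)+
  have "(\<integral>t. X t + Y t \<partial>lborel01) = K 1 - K 0"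
  proof (rule integral01_FTC)
    show "continuous_on {0..1} K"
      unfolding K_def[abs_def] by (intro continuous_intros continuous_rate logc)
    fix t :: real assume t: "t \<in> {0<..<1}"
    then have p: "\<phi> t > 0" "v t > 0" using pos[of t] v_ge[of t] by auto
    have "((\<lambda>t. ln (v t) - ln (\<phi> t)) has_real_derivative 1 / v t * deriv v t - 1 / \<phi> t * (\<phi> t * rate t)) (at t)"
      by (intro DERIV_diff DERIV_chain2[OF DERIV_ln_divide] p dv(1) \<phi>_deriv t)
    from DERIV_mult[OF DERIV_cmult[OF rate_deriv[OF t], of "2 * l"] this]
    have "(K has_real_derivative 2 * l * (dpot (\<phi> t) * \<phi> t / (2 * l)) * (ln (v t) - ln (\<phi> t))
       + (1 / v t * deriv v t - 1 / \<phi> t * (\<phi> t * rate t)) * (2 * l * rate t)) (at t)"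
      by (simp add: K_def[abs_def])
    moreover have "2 * l * (dpot (\<phi> t) * \<phi> t / (2 * l)) * (ln (v t) - ln (\<phi> t))
       + (1 / v t * deriv v t - 1 / \<phi> t * (\<phi> t * rate t)) * (2 * l * rate t) = X t + Y t"
      using p l by (simp add: X_def Y_def q_def)
    ultimately show "(K has_real_derivative X t + Y t) (at t)" by simp
  next
    show "integrable lborel01 (\<lambda>t. X t + Y t)"
      unfolding X_def Y_def
      by (intro Bochner_Integration.integrable_add integrable_mult_right L2_mult L2_diff qL
          L2_continuous continuous_intros continuous_rate cont logc)
  qed
  also have "K 1 - K 0 = 0" by (simp add: K_def v01 \<phi>0 \<phi>1)
  finally have XY: "(\<integral>t. X t + Y t \<partial>lborel01) = 0" .
  have rL: "rate \<in> L2" by (rule L2_continuous[OF continuous_rate])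
  have Xc: "continuous_on {0..1} X"
    unfolding X_def[abs_def] by (intro continuous_intros cont logc)
  have Xi: "integrable lborel01 X" by (rule L2_integrable[OF L2_continuous[OF Xc]])
  have Yi: "integrable lborel01 Y"
    unfolding Y_def[abs_def] by (intro integrable_mult_right L2_mult L2_diff qL rL)
  have pi: "integrable lborel01 (\<lambda>t. pot (\<phi> t))" "integrable lborel01 (\<lambda>t. pot (v t))"
    by (intro L2_integrable L2_continuous continuous_intros cont vc)+
  have Jv: "J v = (\<integral>t. pot (v t) \<partial>lborel01)"
  proof (rule J_eq(2)[where C=R])
    show "AE t in lborel01. \<bar>v t\<bar> \<le> R"
    proof (rule AE01I)
      fix t :: real assume "t \<in> {0<..<1}"
      then show "\<bar>v t\<bar> \<le> R" using v_ge[of t] v_le[of t] by auto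
    qed
  qed (rule L2D(1)[OF L2_continuous[OF vc]])
  define Z where "Z t = pot (v t) - pot (\<phi> t) - X t" for t
  have Zi: "integrable lborel01 Z" unfolding Z_def[abs_def] using pi Xi by simp
  have Z0: "0 \<le> Z t" if "t \<in> {0..1}" for t
    using pot_log_convex(1)[OF ge1 v_ge, OF that that] by (simp add: Z_def X_def)
  \<comment> \<open>The square lies above its tangents; the slack is
    \<open>l * (q t - rate t)^2\<close>. The right side is nonpositive by the constraint on
    \<open>v\<close> and the equality for \<phi>.\<close>
  have "(\<integral>t. Y t \<partial>lborel01) \<le> (\<integral>t. l * (q t)\<^sup>2 - l * (rate t)\<^sup>2 \<partial>lborel01)"
  proof (rule integral_mono[OF Yi])
    show "integrable lborel01 (\<lambda>t. l * (q t)\<^sup>2 - l * (rate t)\<^sup>2)"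
      using L2D(2)[OF qL] L2D(2)[OF rL] by simp
    fix t
    have "0 \<le> l * (q t - rate t)\<^sup>2" using l by simp
    then show "Y t \<le> l * (q t)\<^sup>2 - l * (rate t)\<^sup>2"
      by (simp add: Y_def power2_eq_square algebra_simps)
  qed
  also have "\<dots> = l * (\<integral>t. (q t)\<^sup>2 \<partial>lborel01) - l * (\<integral>t. (rate t)\<^sup>2 \<partial>lborel01)"
    using L2D(2)[OF qL] L2D(2)[OF rL] by simp
  also have "\<dots> \<le> 0" using qA A l by simp
  finally have "(\<integral>t. Y t \<partial>lborel01) \<le> 0" .
  then have "0 \<le> (\<integral>t. X t \<partial>lborel01)" using XY Xi Yi by simp
  moreover have "(\<integral>t. Z t \<partial>lborel01) = J v - J \<phi> - (\<integral>t. X t \<partial>lborel01)"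
    unfolding Z_def Jv J_eq_pot using pi Xi by simp
  ultimately have Zle: "(\<integral>t. Z t \<partial>lborel01) \<le> J v - J \<phi>" by simp
  have Zae: "AE t in lborel01. 0 \<le> Z t" by (rule AE01I) (simp add: Z0)
  show "J \<phi> \<le> J v" using integral_nonneg_AE[OF Zae] Zle by simp
  assume "J v \<le> J \<phi>"
  then have "(\<integral>t. Z t \<partial>lborel01) = 0" using integral_nonneg_AE[OF Zae] Zle by simp
  then have "AE t in lborel01. Z t = 0" using integral_nonneg_eq_0_iff_AE[OF Zi Zae] by simp
  then have ae: "AE t in lborel01. v t = \<phi> t"
  proof (rule AE_mp[OF _ AE01I], intro impI)
    fix t :: real assume t: "t \<in> {0<..<1}" and "Z t = 0"
    then show "v t = \<phi> t"
      using pot_log_convex(2)[OF ge1[of t] v_ge[of t]] by (simp add: Z_def X_def)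
  qed
  have *: "v t = \<phi> t" if "t \<in> {0<..<1}" for t
    by (rule AE01_continuous_eq[OF continuous_on_subset[OF vc] continuous_on_subset[OF cont] ae that]) auto
  assume "t \<in> {0..1}"
  then consider "t = 0" | "t = 1" | "t \<in> {0<..<1}" by fastforce
  then show "v t = \<phi> t" using * v01 \<phi>0 \<phi>1 by cases auto
qed

end

section \<open>From critical points to the first-order equation\<close>

text \<open>Excludes zeros of \<open>\<phi>\<close>, where the integrand of \<open>G\<close> would be the junk value 0: up to the first
  zero, \<open>ln \<phi>\<close> is bounded by the integral of \<open>\<bar>p / \<phi>\<bar>\<close>.\<close>

lemma pos_if_log_slope_L2:
  fixes \<phi> p :: "real \<Rightarrow> real"
  assumes cont: "continuous_on {0..1} \<phi>" and "\<phi> 0 = 1"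
    and p: "\<And>t. t \<in> {0<..<1} \<Longrightarrow> (\<phi> has_real_derivative p t) (at t)"
    and q: "(\<lambda>t. p t / \<phi> t) \<in> L2" and t: "t \<in> {0..1}"
  shows "\<phi> t > 0"
proof (rule ccontr)
  assume "\<not> \<phi> t > 0"
  let ?S = "{t \<in> {0..1}. \<phi> t \<le> 0}"
  have "closed ?S" using continuous_on_closed_Collect_le[OF cont continuous_on_const, of 0] by simp
  then have "compact ({0..1} \<inter> ?S)" by (rule compact_Int_closed[OF compact_Icc])
  also have "{0..1} \<inter> ?S = ?S" by auto
  finally have "compact ?S" .
  moreover have "t \<in> ?S" using t \<open>\<not> \<phi> t > 0\<close> by simp
  then have "?S \<noteq> {}" by blast
  ultimately obtain T where T: "T \<in> ?S" "\<And>s. s \<in> ?S \<Longrightarrow> T \<le> s"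
    using compact_attains_inf[of ?S] by blast
  have T0: "0 < T" using T(1) assms(2) by (cases "T = 0") auto
  have pos: "\<phi> s > 0" if "s \<in> {0..<T}" for s
    using T(2)[of s] that T(1) by force
  define M where "M = integral {0<..<1} (\<lambda>t. \<bar>p t / \<phi> t\<bar>)"
  have si: "set_integrable lborel {0<..<1} (\<lambda>t. \<bar>p t / \<phi> t\<bar>)"
    using L2_integrable[OF q] by (simp add: set_integrable01 del: abs_divide)
  have int: "(\<lambda>t. \<bar>p t / \<phi> t\<bar>) integrable_on {0<..<1}"
    by (rule set_borel_integral_eq_integral(1)[OF si])
  have lower: "exp (- M) \<le> \<phi> s" if s: "s \<in> {0<..<T}" for s
  proof -
    have "((\<lambda>t. p t / \<phi> t) has_integral (ln (\<phi> s) - ln (\<phi> 0))) {0..s}"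
    proof (rule fundamental_theorem_of_calculus_interior)
      show "continuous_on {0..s} (\<lambda>t. ln (\<phi> t))"
        by (intro continuous_intros continuous_on_subset[OF cont]) (use s T(1) pos in force)+
      fix x assume x: "x \<in> {0<..<s}"
      then have "x \<in> {0<..<1}" "\<phi> x > 0" using s T(1) pos[of x] by auto
      from DERIV_chain2[OF DERIV_ln_divide[OF this(2)] p[OF this(1)]]
      show "((\<lambda>t. ln (\<phi> t)) has_vector_derivative p x / \<phi> x) (at x)"
        by (simp add: has_real_derivative_iff_has_vector_derivative)
    qed (use s in auto)
    then have "((\<lambda>t. p t / \<phi> t) has_integral ln (\<phi> s)) {0<..<s}"
      using assms(2) by (simp add: has_integral_Icc_iff_Ioo)
    then have I: "integral {0<..<s} (\<lambda>t. p t / \<phi> t) = ln (\<phi> s)" "(\<lambda>t. p t / \<phi> t) integrable_on {0<..<s}"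
      by (auto simp: integral_unique)
    have int': "(\<lambda>t. \<bar>p t / \<phi> t\<bar>) integrable_on {0<..<s}"
    proof -
      have "set_integrable lborel {0<..<s} (\<lambda>t. \<bar>p t / \<phi> t\<bar>)"
        by (rule set_integrable_subset[OF si]) (use s T(1) in auto)
      then show ?thesis by (rule set_borel_integral_eq_integral(1))
    qed
    have "\<bar>ln (\<phi> s)\<bar> \<le> integral {0<..<s} (\<lambda>t. \<bar>p t / \<phi> t\<bar>)"
      using integral_norm_bound_integral[OF I(2) int'] I(1) by simp
    also have "\<dots> \<le> M"
      unfolding M_def by (rule integral_subset_le[OF _ int' int]) (use s T(1) in auto)
    finally have "- M \<le> ln (\<phi> s)" by linarith
    then have "exp (- M) \<le> exp (ln (\<phi> s))" by (simp only: exp_le_cancel_iff)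
    then show ?thesis using pos[of s] s by (simp only: exp_ln atLeastLessThan_iff greaterThanLessThan_iff less_imp_le)
  qed
  \<comment> \<open>The lower bound is uniform in s < T, so by continuity it persists at T, against
    \<open>\<phi> T \<le> 0\<close>.\<close>
  have "continuous_on {0..T} \<phi>" using cont T(1) by (auto intro: continuous_on_subset)
  then have "exp (- M) \<le> \<phi> T"
    using continuous_ge_on_closure[of "{0<..<T}" \<phi> T "exp (- M)"] T0 lower by simp
  moreover have "exp (- M) > 0" by simp
  ultimately have "0 < \<phi> T" by linarith
  then show False using T(1) by auto
qed

text \<open>Tested against test functions only, stationarity says that \<open>?b\<close> has the
  weak derivative \<open>?a\<close>. But \<open>?b\<close> is C1 with derivative \<open>?b'\<close>,
  so the two agree almost everywhere and, being continuous, at every interior point. Nothing is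
  asserted at 0 and 1, where \<phi>' may be singular.\<close>

lemma critical_imp_Euler_Lagrange:
  assumes C2: "\<phi> \<in> C2_on {0<..<1}" and cont: "continuous_on {0..1} \<phi>"
    and pos: "\<And>t. t \<in> {0..1} \<Longrightarrow> \<phi> t > 0"
    and q: "(\<lambda>t. deriv \<phi> t / \<phi> t) \<in> L2"
    and crit: "critical_point (\<lambda>\<xi>. ereal (J \<xi>) + ereal l * G A \<xi>) W012 \<phi>"
    and t: "t \<in> {0<..<1}"
  shows "2 * l * (deriv (deriv \<phi>) t * \<phi> t - (deriv \<phi> t)\<^sup>2) = dpot (\<phi> t) * \<phi> t ^ 3"
proof -
  have C1: "\<phi> C1_differentiable_on {0<..<1}" "deriv \<phi> C1_differentiable_on {0<..<1}"
    using C2 by (auto simp: C2_on_def)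
  note d1 = C1_differentiable_onD[OF C1(1)] and d2 = C1_differentiable_onD[OF C1(2)]
  let ?p = "deriv \<phi>"
  have c\<phi>: "continuous_on {0<..<1} \<phi>" using cont by (auto intro: continuous_on_subset)
  have \<phi>0: "\<phi> t \<noteq> 0" if "t \<in> {0<..<1}" for t using pos[of t] that by auto
  have w: "has_weak_derivative \<phi> ?p" by (rule has_weak_derivative_C1[OF d1])
  obtain C where C: "C > 0" "\<And>t. t \<in> {0..1} \<Longrightarrow> \<bar>\<phi> t\<bar> \<le> C" using bounded01_continuous[OF cont] by metis
  obtain t0 where t0: "t0 \<in> {0..1}" "\<And>t. t \<in> {0..1} \<Longrightarrow> \<phi> t0 \<le> \<phi> t"
    using continuous_attains_inf[OF _ _ cont] by auto
  \<comment> \<open>Square integrability passes from \<phi>' / \<phi> to \<phi>' because \<phi> is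
    bounded; the minimum \<open>\<phi> t0 > 0\<close> will supply the lower bound for the Gateaux
    derivative.\<close>
  have pL: "?p \<in> L2"
  proof (rule L2_bound)
    show "?p \<in> borel_measurable lborel01" by (rule measurable01_continuous[OF d1(2)])
    show "integrable lborel01 (\<lambda>t. C\<^sup>2 * (?p t / \<phi> t)\<^sup>2)" using L2D(2)[OF q] by (rule integrable_mult_right)
    show "AE t in lborel01. (?p t)\<^sup>2 \<le> C\<^sup>2 * (?p t / \<phi> t)\<^sup>2"
    proof (rule AE01I)
      fix t :: real assume t: "t \<in> {0<..<1}"
      have "\<bar>\<phi> t\<bar>\<^sup>2 \<le> C\<^sup>2" using C(2)[of t] t by (intro power_mono) auto
      then have "(\<phi> t)\<^sup>2 * (?p t / \<phi> t)\<^sup>2 \<le> C\<^sup>2 * (?p t / \<phi> t)\<^sup>2" unfolding power2_abs by (rule mult_right_mono) simp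
      then show "(?p t)\<^sup>2 \<le> C\<^sup>2 * (?p t / \<phi> t)\<^sup>2" using \<phi>0[OF t] by (simp add: power_divide)
    qed
  qed
  let ?b = "\<lambda>t. 2 * l * ?p t / (\<phi> t)\<^sup>2" and ?a = "\<lambda>t. dpot (\<phi> t) - 2 * l * (?p t)\<^sup>2 / \<phi> t ^ 3"
  let ?b' = "\<lambda>t. 2 * l * (deriv ?p t / (\<phi> t)\<^sup>2 - 2 * (?p t)\<^sup>2 / \<phi> t ^ 3)"
  have ca: "continuous_on {0<..<1} ?a" and cb: "continuous_on {0<..<1} ?b" and cb': "continuous_on {0<..<1} ?b'"
    using \<phi>0 by (intro continuous_intros c\<phi> d1(2) d2(2); force)+
  have "has_weak_derivative ?b ?a"
    unfolding has_weak_derivative01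
  proof (intro conjI ballI)
    show "loc_integrable ?b" "loc_integrable ?a" using ca cb by (auto intro: loc_integrable_continuous)
    fix \<eta> assume \<eta>: "\<eta> \<in> test_fun"
    obtain B where B: "B > 0" "AE t in lborel01. \<bar>\<eta> t\<bar> \<le> B" by (rule W012_bounded[OF test_fun_W012[OF \<eta>]])
    let ?D = "\<integral>t. dpot (\<phi> t) * \<eta> t + l * (2 * (?p t / \<phi> t) * (deriv \<eta> t - ?p t / \<phi> t * \<eta> t) / \<phi> t) \<partial>lborel01"
    have "has_gateaux_derivative (\<lambda>\<xi>. ereal (J \<xi>) + ereal l * G A \<xi>) \<phi> \<eta> ?D"
    proof (rule gateaux_derivative_functional[OF _ _ _ w pL B test_fun_has_weak_derivative[OF \<eta>] test_fun_L2(2)[OF \<eta>]])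
      show "0 < \<phi> t0" using pos t0 by simp
      show "AE t in lborel01. \<phi> t0 \<le> \<phi> t" by (rule AE01I) (use t0 in auto)
      show "AE t in lborel01. \<phi> t \<le> C"
      proof (rule AE01I)
        fix t :: real assume "t \<in> {0<..<1}"
        then show "\<phi> t \<le> C" using C(2)[of t] by auto
      qed
    qed
    moreover have "has_gateaux_derivative (\<lambda>\<xi>. ereal (J \<xi>) + ereal l * G A \<xi>) \<phi> \<eta> 0"
      using crit test_fun_W012[OF \<eta>] by (simp add: critical_point_def)
    ultimately have "?D = 0"
      unfolding has_gateaux_derivative_def using DERIV_unique by blast
    also have "?D = (\<integral>t. ?a t * \<eta> t + ?b t * deriv \<eta> t \<partial>lborel01)"
    proof (rule Bochner_Integration.integral_cong)
      fix t assume "t \<in> space lborel01"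
      then have "\<phi> t \<noteq> 0" using \<phi>0 by simp
      then show "dpot (\<phi> t) * \<eta> t + l * (2 * (?p t / \<phi> t) * (deriv \<eta> t - ?p t / \<phi> t * \<eta> t) / \<phi> t) = ?a t * \<eta> t + ?b t * deriv \<eta> t"
        by (simp add: divide_simps) (simp add: eval_nat_numeral algebra_simps)
    qed simp
    also have "\<dots> = (\<integral>t. ?a t * \<eta> t \<partial>lborel01) + (\<integral>t. ?b t * deriv \<eta> t \<partial>lborel01)"
      by (intro Bochner_Integration.integral_add loc_integrable_test_fun \<eta> loc_integrable_continuous ca cb)
    finally show "(\<integral>t. ?b t * deriv \<eta> t \<partial>lborel01) = - (\<integral>t. ?a t * \<eta> t \<partial>lborel01)" by simp
  qed
  moreover have "has_weak_derivative ?b ?b'"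
  proof (rule has_weak_derivative_C1[OF _ cb'])
    fix t :: real assume t: "t \<in> {0<..<1}"
    have "(?b has_real_derivative (2 * l * deriv ?p t * (\<phi> t)\<^sup>2 - 2 * l * ?p t * (2 * \<phi> t * ?p t)) / ((\<phi> t)\<^sup>2 * (\<phi> t)\<^sup>2)) (at t)"
      by (rule DERIV_divide[OF DERIV_cmult[OF d2(1)[OF t]]])
         (use d1(1)[OF t] \<phi>0[OF t] in \<open>auto intro!: derivative_eq_intros\<close>)
    moreover have "(2 * l * deriv ?p t * (\<phi> t)\<^sup>2 - 2 * l * ?p t * (2 * \<phi> t * ?p t)) / ((\<phi> t)\<^sup>2 * (\<phi> t)\<^sup>2) = ?b' t"
      using \<phi>0[OF t] by (simp add: divide_simps) (simp add: eval_nat_numeral algebra_simps)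
    ultimately show "(?b has_real_derivative ?b' t) (at t)" by simp
  qed
  ultimately have "AE t in lborel01. ?b' t = ?a t" by (rule has_weak_derivative_unique[rotated])
  then have "?b' t = ?a t" by (rule AE01_continuous_eq[OF cb' ca _ t])
  moreover have "\<phi> t ^ 3 * ?b' t = 2 * l * (deriv ?p t * \<phi> t - 2 * (?p t)\<^sup>2)"
    "\<phi> t ^ 3 * ?a t = dpot (\<phi> t) * \<phi> t ^ 3 - 2 * l * (?p t)\<^sup>2"
    using \<phi>0[OF t] by (simp_all add: field_simps eval_nat_numeral)
  ultimately show ?thesis by (simp add: algebra_simps)
qed

text \<open>\<open>pot s\<close> factors as ((s + 1)^2 + 1) (s - 1)^2. The double zero at 1 makes
  the Gronwall argument work and the time integral diverge as m tends to 0.\<close>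

lemma pot_upper:
  assumes "0 \<le> s" "s \<le> C"
  shows "pot s \<le> ((C + 1)\<^sup>2 + 1) * (s - 1)\<^sup>2"
proof -
  have "pot s = ((s + 1)\<^sup>2 + 1) * (s - 1)\<^sup>2"
    by (simp add: pot_def power2_eq_square algebra_simps)
  moreover have "(s + 1)\<^sup>2 \<le> (C + 1)\<^sup>2" using assms by (intro power_mono) auto
  ultimately show ?thesis by (simp add: mult_right_mono)
qed

lemma critical_imp_trajectory:
  assumes R: "R > 1" and l: "l > 0" and C2: "\<phi> \<in> C2_on {0<..<1}" and Q: "\<phi> \<in> Q12 R"
    and crit: "critical_point (\<lambda>\<xi>. ereal (J \<xi>) + ereal l * G A \<xi>) W012 \<phi>"
    and G: "G A \<phi> = 0"
  obtains m where "trajectory R l m \<phi>"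
proof -
  have cont: "continuous_on {0..1} \<phi>" and \<phi>01: "\<phi> 0 = 1" "\<phi> 1 = R"
    using Q by (auto simp: Q12_def)
  have C1: "\<phi> C1_differentiable_on {0<..<1}" "deriv \<phi> C1_differentiable_on {0<..<1}"
    using C2 by (auto simp: C2_on_def)
  note d1 = C1_differentiable_onD[OF C1(1)] and d2 = C1_differentiable_onD[OF C1(2)]
  define q where "q t = deriv \<phi> t / \<phi> t" for t
  have w: "has_weak_derivative \<phi> (deriv \<phi>)" by (rule has_weak_derivative_C1[OF d1])
  have qL: "(\<lambda>t. deriv \<phi> t / \<phi> t) \<in> L2"
    using G_bounded_imp_L2[OF w, of A 0] G by (simp add: zero_ereal_def)
  have pos: "\<phi> t > 0" if "t \<in> {0..1}" for t
    by (rule pos_if_log_slope_L2[OF cont \<phi>01(1) d1(1) qL that])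
  have pos': "\<phi> t > 0" if "t \<in> {0<..<1}" for t using pos[of t] that by simp
  have q\<phi>: "deriv \<phi> t = q t * \<phi> t" if "t \<in> {0<..<1}" for t
    using pos'[OF that] by (simp add: q_def)
  have qc: "continuous_on {0<..<1} q"
    unfolding q_def[abs_def]
    by (intro continuous_intros d1(2) continuous_on_subset[OF cont]) (use pos' in force)+
  obtain m where m: "\<And>t. t \<in> {0<..<1} \<Longrightarrow> l * (q t)\<^sup>2 - pot (\<phi> t) = m"
  proof -
    have "\<exists>m. \<forall>t\<in>{0<..<1}. l * (q t)\<^sup>2 - pot (\<phi> t) = m"
    proof (rule has_field_derivative_zero_constant)
      fix t :: real assume t: "t \<in> {0<..<1}"
      let ?q' = "(deriv (deriv \<phi>) t * \<phi> t - deriv \<phi> t * deriv \<phi> t) / (\<phi> t * \<phi> t)"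
      have "\<phi> t \<noteq> 0" using pos'[OF t] by simp
      from DERIV_divide[OF d2(1)[OF t] d1(1)[OF t] this]
      have "(q has_real_derivative ?q') (at t)" by (simp add: q_def[abs_def])
      then have "((\<lambda>t. l * (q t)\<^sup>2 - pot (\<phi> t)) has_real_derivative l * (2 * q t * ?q') - dpot (\<phi> t) * deriv \<phi> t) (at t)"
        by (auto intro!: derivative_eq_intros DERIV_chain2[OF pot_has_derivative] d1(1)[OF t])
      moreover have "l * (2 * q t * ?q') - dpot (\<phi> t) * deriv \<phi> t = 0"
      proof -
        have "2 * l * (deriv (deriv \<phi>) t * \<phi> t - deriv \<phi> t * deriv \<phi> t) = dpot (\<phi> t) * \<phi> t ^ 3"
          using critical_imp_Euler_Lagrange[OF C2 cont pos qL crit t] by (simp add: power2_eq_square)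
        then have "2 * l * ?q' = dpot (\<phi> t) * \<phi> t"
          using pos'[OF t] by (simp add: divide_simps power3_eq_cube)
        moreover have "l * (2 * q t * ?q') = 2 * l * ?q' * q t" by simp
        ultimately show ?thesis by (simp add: q\<phi>[OF t])
      qed
      ultimately show "((\<lambda>t. l * (q t)\<^sup>2 - pot (\<phi> t)) has_real_derivative 0) (at t within {0<..<1})"
        by (metis has_field_derivative_at_within)
    qed simp
    with that show thesis by blast
  qed
  have q2: "l * (q t)\<^sup>2 = m + pot (\<phi> t)" if "t \<in> {0<..<1}" for t
    using m[OF that] by simp
  \<comment> \<open>\<phi>' need not have a limit at 0, but l q^2 \<ge> 0 in the interior, and this
    inequality passes to the end point by continuity of \<phi> alone.\<close>
  have "0 \<le> m + pot (\<phi> 0)"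
  proof (rule continuous_ge_on_closure[of "{0<..<1::real}" "\<lambda>t. m + pot (\<phi> t)"])
    show "continuous_on (closure {0<..<1}) (\<lambda>t. m + pot (\<phi> t))"
      by (auto intro!: continuous_intros cont)
    fix t :: real assume "t \<in> {0<..<1}"
    then show "0 \<le> m + pot (\<phi> t)" using q2[of t] l by (metis less_imp_le mult_nonneg_nonneg zero_le_power2)
  qed simp
  then have m0: "0 \<le> m" by (simp add: \<phi>01 pot_def)
  have "m \<noteq> 0"
  proof
    assume "m = 0"
    obtain C where C: "C > 0" "\<And>t. t \<in> {0..1} \<Longrightarrow> \<bar>\<phi> t\<bar> \<le> C" using bounded01_continuous[OF cont] by metis
    \<comment> \<open>From \<phi>' = q \<phi>: the factor \<open>C\<close> bounds \<phi>, and the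
      root bounds |q| / |\<phi> - 1| through \<open>pot_upper\<close> when m = 0.\<close>
    define K where "K = C * sqrt (((C + 1)\<^sup>2 + 1) / l)"
    \<comment> \<open>Gronwall: for \<open>\<mu> = 0\<close> the first integral gives \<open>\<bar>\<phi>'\<bar> \<le> K \<bar>\<phi> - 1\<bar>\<close>\<close>
    define E where "E t = (\<phi> t - 1)\<^sup>2 * exp (- (2 * K) * t)" for t
    have "E 1 \<le> E 0"
    proof (rule DERIV_nonpos_imp_decreasing_open[of 0 1 E])
      show "continuous_on {0..1} E" unfolding E_def[abs_def] by (intro continuous_intros cont)
      fix t :: real assume "0 < t" "t < 1"
      then have t: "t \<in> {0<..<1}" by simp
      have "(E has_real_derivative (2 * (\<phi> t - 1) * deriv \<phi> t - 2 * K * (\<phi> t - 1)\<^sup>2) * exp (- (2 * K) * t)) (at t)"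
        unfolding E_def[abs_def] by (rule derivative_eq_intros d1(1)[OF t] refl)+ (simp add: algebra_simps)
      moreover have "2 * (\<phi> t - 1) * deriv \<phi> t - 2 * K * (\<phi> t - 1)\<^sup>2 \<le> 0"
      proof -
        have \<phi>C: "\<phi> t \<le> C" using C(2)[of t] t by auto
        have "(q t)\<^sup>2 = pot (\<phi> t) / l" using q2[OF t] \<open>m = 0\<close> l by (simp add: field_simps)
        also have "\<dots> \<le> ((C + 1)\<^sup>2 + 1) * (\<phi> t - 1)\<^sup>2 / l"
          using l pos'[OF t] \<phi>C by (intro divide_right_mono pot_upper) auto
        finally have "sqrt ((q t)\<^sup>2) \<le> sqrt (((C + 1)\<^sup>2 + 1) / l * (\<phi> t - 1)\<^sup>2)"
          by (intro real_sqrt_le_mono) simp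
        then have "\<bar>q t\<bar> \<le> sqrt (((C + 1)\<^sup>2 + 1) / l) * \<bar>\<phi> t - 1\<bar>"
          by (simp add: real_sqrt_mult real_sqrt_divide)
        then have "\<bar>q t\<bar> * \<phi> t \<le> sqrt (((C + 1)\<^sup>2 + 1) / l) * \<bar>\<phi> t - 1\<bar> * C"
          using \<phi>C pos'[OF t] C(1) l by (intro mult_mono) auto
        then have "\<bar>deriv \<phi> t\<bar> \<le> K * \<bar>\<phi> t - 1\<bar>"
          using pos'[OF t] by (simp add: q\<phi>[OF t] K_def abs_mult mult_ac)
        then have "\<bar>\<phi> t - 1\<bar> * \<bar>deriv \<phi> t\<bar> \<le> \<bar>\<phi> t - 1\<bar> * (K * \<bar>\<phi> t - 1\<bar>)"
          by (rule mult_left_mono) simp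
        also have "\<dots> = K * (\<phi> t - 1)\<^sup>2" by (simp add: power2_eq_square)
        finally have "(\<phi> t - 1) * deriv \<phi> t \<le> K * (\<phi> t - 1)\<^sup>2"
          unfolding abs_mult[symmetric] by (rule order_trans[OF abs_ge_self])
        then show ?thesis unfolding mult.assoc by linarith
      qed
      ultimately show "\<exists>y. (E has_real_derivative y) (at t) \<and> y \<le> 0"
        by (intro exI conjI) (auto simp: mult_le_0_iff)
    qed simp
    then have "(R - 1)\<^sup>2 * exp (- (2 * K)) \<le> 0" by (simp add: E_def \<phi>01)
    then show False using R by (simp add: mult_le_0_iff)
  qed
  with m0 have mpos: "m > 0" by simp
  have qne: "q t \<noteq> 0" if "t \<in> {0<..<1}" for t
    using q2[OF that] mpos pot_nonneg[of "\<phi> t"] by auto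
  \<comment> \<open>\<open>q\<close> is continuous without zeros, so one positive value fixes its
    sign; the mean value theorem supplies one because \<phi> rises from 1 to R.\<close>
  obtain x where x: "x \<in> {0<..<1}" "q x > 0"
  proof -
    have "\<exists>y x. 0 < x \<and> x < 1 \<and> (\<phi> has_real_derivative y) (at x) \<and> \<phi> 1 - \<phi> 0 = (1 - 0) * y"
    proof (rule MVT)
      show "\<phi> differentiable (at x)" if "0 < x" "x < 1" for x
        using d1(1)[of x] that real_differentiable_def by auto
    qed (use cont in auto)
    then obtain y x where x: "0 < x" "x < 1" "(\<phi> has_real_derivative y) (at x)" "\<phi> 1 - \<phi> 0 = y" by auto
    then have "y = deriv \<phi> x" using d1(1)[of x] DERIV_unique by auto
    then have "deriv \<phi> x > 0" using x \<phi>01 R by simp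
    then have "q x > 0" using x pos'[of x] by (simp add: q_def)
    with x that show thesis by auto
  qed
  have qpos: "q t > 0" if t: "t \<in> {0<..<1}" for t
  proof (rule ccontr)
    assume "\<not> q t > 0"
    moreover have "connected (q ` {0<..<1})" by (rule connected_continuous_image[OF qc]) simp
    then have "{q t..q x} \<subseteq> q ` {0<..<1}" using t x by (intro connected_contains_Icc) auto
    ultimately have "0 \<in> q ` {0<..<1}" using x by auto
    then show False using qne by auto
  qed
  have "trajectory R l m \<phi>"
  proof
    fix t :: real assume t: "t \<in> {0<..<1}"
    have "(q t)\<^sup>2 = (m + pot (\<phi> t)) / l" using q2[OF t] l by (simp add: field_simps)
    then have "q t = sqrt ((m + pot (\<phi> t)) / l)" using qpos[OF t] by (simp add: real_sqrt_unique)
    then have "deriv \<phi> t = \<phi> t * (sqrt (m + pot (\<phi> t)) / sqrt l)"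
      by (simp add: q\<phi>[OF t] real_sqrt_divide)
    then show "(\<phi> has_real_derivative \<phi> t * (sqrt (m + pot (\<phi> t)) / sqrt l)) (at t)"
      using d1(1)[OF t] by simp
  qed (use R l mpos cont \<phi>01 pos in auto)
  then show thesis by (rule that)
qed

section \<open>The multiplier system\<close>

lemma LBINT_Icc_eq_integral:
  fixes f :: "real \<Rightarrow> real"
  assumes "continuous_on {a..b} f"
  shows "(LBINT s:{a..b}. f s) = integral {a..b} f"
  by (rule set_borel_integral_eq_integral(2)) (rule borel_integrable_atLeastAtMost'[OF assms])

text \<open>Times \<open>sqrt l\<close>, this is the time a solution of the first-order equation
  takes to travel from 1 to R.\<close>

definition time_integral :: "real \<Rightarrow> real \<Rightarrow> real" where
  "time_integral R m = integral {1..R} (\<lambda>s. 1 / (s * sqrt (m + pot s)))"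

text \<open>Divided by \<open>sqrt l\<close>, this is the integral of u'^2 along the solution,
  rewritten as the integral of u' du with du = ds / s.\<close>

definition action_integral :: "real \<Rightarrow> real \<Rightarrow> real" where
  "action_integral R m = integral {1..R} (\<lambda>s. sqrt (m + pot s) / s)"

lemma continuous_on_time_integrand:
  assumes "m > 0" "\<And>s. s \<in> S \<Longrightarrow> s > 0"
  shows "continuous_on S (\<lambda>s. 1 / (s * sqrt (m + pot s)))"
proof -
  have "s * sqrt (m + pot s) \<noteq> 0" if "s \<in> S" for s
    using assms(2)[OF that] add_pot_pos[OF assms(1), of s] by simp
  then show ?thesis by (intro continuous_intros) auto
qed

lemma continuous_on_action_integrand:
  assumes "\<And>s. s \<in> S \<Longrightarrow> s > 0"
  shows "continuous_on S (\<lambda>s. sqrt (m + pot s) / s)"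
  by (intro continuous_intros) (use assms in force)+

lemma multiplier_system_iff:
  assumes "m > 0"
  shows "multiplier_system R A l m \<longleftrightarrow>
    time_integral R m = 1 / sqrt l \<and> 1 / sqrt l * action_integral R m = A"
proof -
  have "(LBINT s:{1..R}. 1 / (s * sqrt (m + pot s))) = time_integral R m"
    unfolding time_integral_def
    by (rule LBINT_Icc_eq_integral, rule continuous_on_time_integrand[OF assms]) auto
  moreover have "(LBINT s:{1..R}. sqrt (m + pot s) / s) = action_integral R m"
    unfolding action_integral_def
    by (rule LBINT_Icc_eq_integral, rule continuous_on_action_integrand) auto
  ultimately show ?thesis by (simp add: multiplier_system_def pot_def add.assoc)
qed

lemma time_integral_pos:
  assumes "R > 1" "m > 0"
  shows "time_integral R m > 0"
proof -
  have "0 \<le> time_integral R m"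
    unfolding time_integral_def
    by (rule integral_nonneg[OF integrable_continuous_real], rule continuous_on_time_integrand[OF assms(2)])
       (use add_pot_pos[OF assms(2)] in \<open>auto intro!: divide_nonneg_nonneg mult_nonneg_nonneg simp: less_imp_le\<close>)
  moreover have "time_integral R m \<noteq> 0"
  proof
    assume "time_integral R m = 0"
    then have "\<forall>s\<in>cbox 1 R. 1 / (s * sqrt (m + pot s)) = 0"
      unfolding time_integral_def cbox_interval[symmetric]
      by (subst (asm) integral_cbox_eq_0_iff)
         (use assms add_pot_pos[OF assms(2)] in \<open>auto intro!: continuous_on_time_integrand divide_nonneg_nonneg mult_nonneg_nonneg simp: less_imp_le\<close>)
    then show False using assms add_pot_pos[OF assms(2), of 1] by auto
  qed
  ultimately show ?thesis by simp
qed

section \<open>Solvability by the intermediate value theorem\<close>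

lemma continuous_time_integral: "continuous_on {0<..} (time_integral R)"
  unfolding time_integral_def[abs_def] cbox_interval[symmetric]
proof (rule integral_continuous_on_param)
  have "m + pot s \<noteq> 0" if "m > 0" for m s using add_pot_pos[OF that, of s] by simp
  then show "continuous_on ({0<..} \<times> cbox 1 R) (\<lambda>(m, s). 1 / (s * sqrt (m + pot s)))"
    by (auto simp: split_beta intro!: continuous_intros)
qed

lemma continuous_action_integral: "continuous_on {0<..} (action_integral R)"
  unfolding action_integral_def[abs_def] cbox_interval[symmetric]
proof (rule integral_continuous_on_param)
  show "continuous_on ({0<..} \<times> cbox 1 R) (\<lambda>(m, s). sqrt (m + pot s) / s)"
    by (auto simp: split_beta intro!: continuous_intros)
qed

lemma integral_one_over:
  assumes "1 \<le> (R::real)"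
  shows "((\<lambda>s. 1 / s) has_integral ln R) {1..R}"
proof -
  have "((\<lambda>s. 1 / s) has_integral (ln R - ln 1)) {1..R}"
    by (rule fundamental_theorem_of_calculus[OF assms])
       (auto intro!: derivative_eq_intros simp: has_real_derivative_iff_has_vector_derivative[symmetric] divide_inverse)
  then show ?thesis by simp
qed

text \<open>\<open>C\<close>, which equals \<open>pot R\<close>, bounds \<open>pot\<close> on
  [1, R]. With m chosen so that m + C = \<kappa>^2 m, the root of m + \<open>pot s\<close> lies
  between sqrt m and \<kappa> sqrt m; the factors sqrt m cancel in the product, leaving at most
  \<kappa> (ln R)^2, which is A by the choice of \<kappa>.\<close>

lemma multiplier_product_upper:
  assumes R: "R > 1" and A: "A > (ln R)\<^sup>2"
  shows "\<exists>m>0. time_integral R m * action_integral R m \<le> A"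
proof -
  define C where "C = ((R + 1)\<^sup>2 + 1) * (R - 1)\<^sup>2"
  have C: "C > 0" using R unfolding C_def by (intro mult_pos_pos add_nonneg_pos) auto
  have potC: "pot s \<le> C" if "s \<in> {1..R}" for s
  proof -
    have "pot s \<le> ((R + 1)\<^sup>2 + 1) * (s - 1)\<^sup>2" using that by (intro pot_upper) auto
    also have "\<dots> \<le> C"
      unfolding C_def using that by (intro mult_left_mono power_mono) auto
    finally show ?thesis .
  qed
  have L: "ln R > 0" using R by simp
  define \<kappa> where "\<kappa> = A / (ln R)\<^sup>2"
  have \<kappa>: "\<kappa> > 1" using A L by (simp add: \<kappa>_def)
  then have \<kappa>2: "\<kappa>\<^sup>2 > 1" by (simp add: one_less_power)
  define m where "m = C / (\<kappa>\<^sup>2 - 1)"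
  have m: "m > 0" using C \<kappa>2 by (simp add: m_def)
  have mC: "m + C = \<kappa>\<^sup>2 * m" using \<kappa>2 by (simp add: m_def field_simps)
  have t: "time_integral R m \<le> 1 / sqrt m * ln R"
    unfolding time_integral_def
  proof (rule has_integral_le[OF integrable_integral has_integral_mult_right[OF integral_one_over]])
    show "(\<lambda>s. 1 / (s * sqrt (m + pot s))) integrable_on {1..R}"
      by (rule integrable_continuous_real, rule continuous_on_time_integrand[OF m]) auto
    fix s assume s: "s \<in> {1..R}"
    have "s * sqrt m \<le> s * sqrt (m + pot s)" using s pot_nonneg[of s] by (intro mult_left_mono) auto
    then have "1 / (s * sqrt (m + pot s)) \<le> 1 / (s * sqrt m)" using s m by (intro divide_left_mono) (auto intro!: mult_pos_pos add_pot_pos)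
    then show "1 / (s * sqrt (m + pot s)) \<le> 1 / sqrt m * (1 / s)" by (simp add: mult.commute)
  qed (use R in auto)
  have a: "action_integral R m \<le> \<kappa> * sqrt m * ln R"
    unfolding action_integral_def
  proof (rule has_integral_le[OF integrable_integral has_integral_mult_right[OF integral_one_over]])
    show "(\<lambda>s. sqrt (m + pot s) / s) integrable_on {1..R}"
      by (rule integrable_continuous_real, rule continuous_on_action_integrand) auto
    fix s assume s: "s \<in> {1..R}"
    have "sqrt (m + pot s) \<le> sqrt (\<kappa>\<^sup>2 * m)" using potC[OF s] mC by simp
    also have "\<dots> = \<kappa> * sqrt m" using \<kappa> by (simp add: real_sqrt_mult)
    finally show "sqrt (m + pot s) / s \<le> \<kappa> * sqrt m * (1 / s)" using s by (simp add: divide_right_mono)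
  qed (use R in auto)
  have "time_integral R m * action_integral R m \<le> (1 / sqrt m * ln R) * (\<kappa> * sqrt m * ln R)"
  proof (rule mult_mono[OF t a])
    show "0 \<le> 1 / sqrt m * ln R" using m L by simp
    show "0 \<le> action_integral R m"
      unfolding action_integral_def
      by (rule integral_nonneg[OF integrable_continuous_real], rule continuous_on_action_integrand)
         (use add_pot_pos[OF m] in \<open>auto intro!: divide_nonneg_nonneg simp: less_imp_le\<close>)
  qed
  also have "\<dots> = A" using m L by (simp add: \<kappa>_def power2_eq_square)
  finally show ?thesis using m by blast
qed

text \<open>Since \<open>pot s \<ge> (s - 1)^2\<close>, the action integral is at least \<sigma> for
  every m > 0. With m = r^2 the root of m + \<open>pot s\<close> is at most r + K (s - 1), so the
  time integral has a lower bound growing like - ln r and exceeds A / \<sigma> once r is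
  small.\<close>

lemma multiplier_product_lower:
  assumes R: "R > 1" and A: "A > 0"
  shows "\<exists>m>0. A \<le> time_integral R m * action_integral R m"
proof -
  \<comment> \<open>K^2 is the factor of (s - 1)^2 in \<open>pot_upper\<close> on [1, R].\<close>
  define K where "K = sqrt ((R + 1)\<^sup>2 + 1)"
  have K: "K > 0" unfolding K_def by (simp add: add_nonneg_pos)
  \<comment> \<open>The integral of (s - 1) / R over [1, R].\<close>
  define \<sigma> where "\<sigma> = (R - 1)\<^sup>2 / (2 * R)"
  have \<sigma>: "\<sigma> > 0" using R by (simp add: \<sigma>_def)
  \<comment> \<open>Solves (ln (K (R - 1)) - ln r) / (R K) = A / \<sigma>, whose left side bounds
    the time integral from below.\<close>
  define r where "r = K * (R - 1) * exp (- (R * K * A / \<sigma>))"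
  have r: "r > 0" using K R by (simp add: r_def)
  define m where "m = r\<^sup>2"
  have m: "m > 0" using r by (simp add: m_def)
  have a: "\<sigma> \<le> action_integral R m"
  proof -
    have "((\<lambda>s. (s - 1) / R) has_integral ((R - 1)\<^sup>2 / (2 * R) - (1 - 1)\<^sup>2 / (2 * R))) {1..R}"
      by (rule fundamental_theorem_of_calculus)
         (use R in \<open>auto intro!: derivative_eq_intros
           simp: has_real_derivative_iff_has_vector_derivative[symmetric] field_simps\<close>)
    then have "((\<lambda>s. (s - 1) / R) has_integral \<sigma>) {1..R}" by (simp add: \<sigma>_def)
    then show ?thesis
      unfolding action_integral_def
    proof (rule has_integral_le[OF _ integrable_integral])
      show "(\<lambda>s. sqrt (m + pot s) / s) integrable_on {1..R}"
        by (rule integrable_continuous_real, rule continuous_on_action_integrand) auto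
      fix s assume s: "s \<in> {1..R}"
      have "(s - 1)\<^sup>2 \<le> m + pot s" using m by (simp add: pot_def)
      then have "s - 1 \<le> sqrt (m + pot s)" by (rule real_le_rsqrt)
      then show "(s - 1) / R \<le> sqrt (m + pot s) / s"
        using s add_pot_pos[OF m, of s] by (intro frac_le) (auto simp: less_imp_le)
    qed
  qed
  have t: "A / \<sigma> \<le> time_integral R m"
  proof -
    define H where "H s = ln (r + K * (s - 1)) / (R * K)" for s
    have p: "r + K * (s - 1) > 0" if "s \<ge> 1" for s using r K that by (intro add_pos_nonneg) auto
    have "((\<lambda>s. 1 / (R * (r + K * (s - 1)))) has_integral (H R - H 1)) {1..R}"
    proof (rule fundamental_theorem_of_calculus)
      fix s assume s: "s \<in> {1..R}"
      have "((\<lambda>s. r + K * (s - 1)) has_real_derivative K) (at s)" by (auto intro!: derivative_eq_intros)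
      moreover have "r + K * (s - 1) > 0" using p[of s] s by simp
      ultimately have "((\<lambda>s. ln (r + K * (s - 1))) has_real_derivative 1 / (r + K * (s - 1)) * K) (at s)"
        by (intro DERIV_chain2[OF DERIV_ln_divide])
      from DERIV_cdivide[OF this, of "R * K"]
      have "(H has_real_derivative 1 / (r + K * (s - 1)) * K / (R * K)) (at s)"
        unfolding H_def[abs_def] .
      moreover have "1 / (r + K * (s - 1)) * K / (R * K) = 1 / (R * (r + K * (s - 1)))" using K by simp
      ultimately show "(H has_vector_derivative 1 / (R * (r + K * (s - 1)))) (at s within {1..R})"
        by (metis has_field_derivative_at_within has_real_derivative_iff_has_vector_derivative)
    qed (use R in simp)
    then have "H R - H 1 \<le> time_integral R m"
      unfolding time_integral_def
    proof (rule has_integral_le[OF _ integrable_integral])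
      show "(\<lambda>s. 1 / (s * sqrt (m + pot s))) integrable_on {1..R}"
        by (rule integrable_continuous_real, rule continuous_on_time_integrand[OF m]) auto
      fix s assume s: "s \<in> {1..R}"
      have "pot s \<le> ((R + 1)\<^sup>2 + 1) * (s - 1)\<^sup>2" using s by (intro pot_upper) auto
      also have "\<dots> = (K * (s - 1))\<^sup>2" by (simp add: K_def power_mult_distrib)
      finally have "m + pot s \<le> r\<^sup>2 + (K * (s - 1))\<^sup>2" by (simp add: m_def)
      also have "\<dots> \<le> (r + K * (s - 1))\<^sup>2" using r K s by (simp add: power2_sum)
      finally have "sqrt (m + pot s) \<le> r + K * (s - 1)" using p[of s] s by (intro real_le_lsqrt) auto
      then have "s * sqrt (m + pot s) \<le> R * (r + K * (s - 1))"
        using s add_pot_pos[OF m, of s] by (intro mult_mono) (auto simp: less_imp_le)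
      then show "1 / (R * (r + K * (s - 1))) \<le> 1 / (s * sqrt (m + pot s))"
        using s add_pot_pos[OF m, of s] by (intro divide_left_mono) (auto intro!: mult_pos_pos p)
    qed
    moreover have "A / \<sigma> \<le> H R - H 1"
    proof -
      have "R * K * A / \<sigma> = ln (K * (R - 1)) - ln r"
        using K R by (simp add: r_def ln_mult)
      also have "\<dots> \<le> ln (r + K * (R - 1)) - ln r"
      proof -
        have "0 < K * (R - 1)" using K R by simp
        then show ?thesis using r by (simp only: diff_right_mono ln_le_cancel_iff add_pos_pos)
      qed
      finally have "R * K * A / \<sigma> / (R * K) \<le> (ln (r + K * (R - 1)) - ln r) / (R * K)"
        using K R by (intro divide_right_mono) auto
      then show ?thesis using K R by (simp add: H_def diff_divide_distrib)
    qed
    ultimately show ?thesis by simp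
  qed
  have "A = A / \<sigma> * \<sigma>" using \<sigma> by simp
  also have "\<dots> \<le> time_integral R m * action_integral R m"
    using t a A \<sigma> order_trans[OF _ t, of 0] by (intro mult_mono) auto
  finally show ?thesis using m by blast
qed

text \<open>The first equation determines l from m; substituted into the second it leaves the single
  equation that the product of the two integrals be A, to which the intermediate value theorem
  applies.\<close>

lemma multiplier_system_solvable:
  assumes R: "R > 1" and A: "A > (ln R)\<^sup>2"
  obtains l m where "l > 0" "m > 0" "multiplier_system R A l m"
proof -
  let ?f = "\<lambda>m. time_integral R m * action_integral R m"
  have "A > 0" using A zero_le_power2[of "ln R"] by linarith
  obtain m1 m2 where m12: "m1 > 0" "m2 > 0" "?f m1 \<le> A" "A \<le> ?f m2"
    using multiplier_product_upper[OF R A] multiplier_product_lower[OF R \<open>A > 0\<close>] by auto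
  have "connected (?f ` {0<..})"
    by (rule connected_continuous_image)
       (auto intro!: continuous_on_mult continuous_time_integral continuous_action_integral)
  then have "{?f m1..?f m2} \<subseteq> ?f ` {0<..}" using m12 by (intro connected_contains_Icc) auto
  then obtain m where m: "m > 0" "?f m = A" using m12 by auto
  define l where "l = 1 / (time_integral R m)\<^sup>2"
  have t: "time_integral R m > 0" by (rule time_integral_pos[OF R m(1)])
  then have "l > 0" "1 / sqrt l = time_integral R m"
    by (auto simp: l_def real_sqrt_divide)
  then show thesis using m that[of l m] by (simp add: multiplier_system_iff)
qed

text \<open>Separation of variables: \<open>F s\<close> is the time at which the value s is reached.
  The first equation of the system is \<open>F R = 1\<close>, the second becomes
  \<open>G A \<phi> = 0\<close>. The equation is delivered at 0 and 1 as well, since the multipliers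
  are later read off from the slopes there.\<close>

lemma multiplier_system_trajectory:
  assumes R: "R > 1" and l: "l > 0" and m: "m > 0" and sys: "multiplier_system R A l m"
  obtains \<phi> where "trajectory R l m \<phi>" "G A \<phi> = 0"
    "(\<integral>t. (trajectory.rate l m \<phi> t)\<^sup>2 \<partial>lborel01) = A"
    "\<And>t. t \<in> {0..1} \<Longrightarrow> (\<phi> has_real_derivative \<phi> t * (sqrt (m + pot (\<phi> t)) / sqrt l)) (at t)"
proof -
  have T: "time_integral R m = 1 / sqrt l" and act: "1 / sqrt l * action_integral R m = A"
    using sys by (auto simp: multiplier_system_iff[OF m])
  define g where "g s = 1 / (s * sqrt (m + pot s))" for s
  define a where "a s = sqrt (m + pot s) / s" for s
  let ?I = "{1 / 2..R + 1}"
  have gc: "continuous_on ?I g"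
    unfolding g_def[abs_def] by (rule continuous_on_time_integrand[OF m]) auto
  have gi: "g integrable_on {x..y}" if "1 / 2 \<le> x" "y \<le> R + 1" for x y
    by (rule integrable_continuous_real, rule continuous_on_subset[OF gc]) (use that in auto)
  \<comment> \<open>\<open>F\<close> is the inverse of the solution; the margins beyond \<open>[1, R]\<close> make the solution
    differentiable at the end points 0 and 1.\<close>
  define F where "F s = sqrt l * (integral {1 / 2..s} g - integral {1 / 2..1} g)" for s
  have F1: "F 1 = 0" by (simp add: F_def)
  have FR: "F R = 1"
  proof -
    have "integral {1 / 2..1} g + integral {1..R} g = integral {1 / 2..R} g"
      by (rule Henstock_Kurzweil_Integration.integral_combine) (use R in \<open>auto intro!: gi\<close>)
    then have "integral {1 / 2..R} g - integral {1 / 2..1} g = time_integral R m"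
      by (simp add: time_integral_def g_def[abs_def])
    then show ?thesis using T l by (simp add: F_def)
  qed
  have gpos: "g s > 0" if "s > 0" for s
    using that add_pot_pos[OF m, of s] by (simp add: g_def)
  have Fd: "(F has_real_derivative sqrt l * g s) (at s within ?I)" if "s \<in> ?I" for s
  proof -
    have "((\<lambda>s. integral {1 / 2..s} g) has_real_derivative g s) (at s within ?I)"
      by (rule integral_has_real_derivative[OF gc that])
    then show ?thesis unfolding F_def[abs_def] by (auto intro!: derivative_eq_intros)
  qed
  have Fd': "(F has_real_derivative sqrt l * g s) (at s)" if "s \<in> {1 / 2<..<R + 1}" for s
  proof -
    have "at s within ?I = at s" by (rule at_within_interior) (use that in \<open>auto simp: interior_atLeastAtMost_real\<close>)
    then show ?thesis using Fd[of s] that by simp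
  qed
  have Fc: "continuous_on ?I F"
    by (rule DERIV_continuous_on[OF Fd])
  have Fmono: "F x < F y" if "x \<in> ?I" "y \<in> ?I" "x < y" for x y
  proof (rule DERIV_pos_imp_increasing_open[OF that(3)])
    fix s assume "x < s" "s < y"
    then have "s \<in> {1 / 2<..<R + 1}" using that by auto
    then show "\<exists>z. (F has_real_derivative z) (at s) \<and> 0 < z"
      using Fd' gpos[of s] l by (intro exI[of _ "sqrt l * g s"]) auto
  qed (rule continuous_on_subset[OF Fc], use that in auto)
  have inj: "inj_on F ?I"
    by (rule inj_onI) (metis Fmono less_irrefl linorder_neqE_linordered_idom)
  define \<phi> where "\<phi> = inv_into ?I F"
  have \<phi>F: "\<phi> (F s) = s" if "s \<in> ?I" for s
    unfolding \<phi>_def by (rule inv_into_f_f[OF inj that])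
  have img: "{F (1 / 2)..F (R + 1)} \<subseteq> F ` ?I"
    by (rule connected_contains_Icc[OF connected_continuous_image[OF Fc]]) (use R in auto)
  have F\<phi>: "F (\<phi> t) = t" "\<phi> t \<in> ?I" if "t \<in> {F (1 / 2)..F (R + 1)}" for t
  proof -
    have "t \<in> F ` ?I" using img that by blast
    then show "F (\<phi> t) = t" "\<phi> t \<in> ?I"
      unfolding \<phi>_def by (rule f_inv_into_f, rule inv_into_into)
  qed
  have ends: "F (1 / 2) < 0" "1 < F (R + 1)"
    using Fmono[of "1 / 2" 1] Fmono[of R "R + 1"] F1 FR R by auto
  have \<phi>c: "continuous_on {F (1 / 2)..F (R + 1)} \<phi>"
    by (rule continuous_on_subset[OF continuous_on_inv[OF Fc] img]) (use \<phi>F in auto)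
  have \<phi>d: "(\<phi> has_real_derivative \<phi> t * (sqrt (m + pot (\<phi> t)) / sqrt l)) (at t)" if t: "t \<in> {0..1}" for t
  proof -
    have t': "t \<in> {F (1 / 2)<..<F (R + 1)}" using t ends by auto
    have "F (\<phi> t) = t" using F\<phi>(1)[of t] t' by simp
    then have "\<phi> t \<noteq> 1 / 2" "\<phi> t \<noteq> R + 1" using t' by (metis greaterThanLessThan_iff less_irrefl)+
    then have \<phi>t: "\<phi> t \<in> {1 / 2<..<R + 1}" using F\<phi>(2)[of t] t' by auto
    have "(\<phi> has_real_derivative inverse (sqrt l * g (\<phi> t))) (at t)"
    proof (rule DERIV_inverse_function[where f=F and g=\<phi>])
      show "(F has_real_derivative sqrt l * g (\<phi> t)) (at (\<phi> t))" by (rule Fd'[OF \<phi>t])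
      show "sqrt l * g (\<phi> t) \<noteq> 0" using gpos[of "\<phi> t"] \<phi>t l by auto
      show "F (1 / 2) < t" "t < F (R + 1)" using t' by auto
      show "F (\<phi> y) = y" if "F (1 / 2) < y" "y < F (R + 1)" for y using F\<phi>(1)[of y] that by simp
      show "isCont \<phi> t" by (rule continuous_on_interior[OF \<phi>c]) (use t' in \<open>simp add: interior_atLeastAtMost_real\<close>)
    qed
    moreover have "inverse (sqrt l * g (\<phi> t)) = \<phi> t * (sqrt (m + pot (\<phi> t)) / sqrt l)"
      by (simp add: g_def field_simps)
    ultimately show ?thesis by simp
  qed
  have tr: "trajectory R l m \<phi>"
  proof
    show "continuous_on {0..1} \<phi>" by (rule continuous_on_subset[OF \<phi>c]) (use ends in auto)
    show "\<phi> 0 = 1" "\<phi> 1 = R" using \<phi>F[of 1] \<phi>F[of R] F1 FR R by auto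
    show "\<phi> t > 0" if "t \<in> {0..1}" for t using F\<phi>(2)[of t] that ends by auto
    show "(\<phi> has_real_derivative \<phi> t * (sqrt (m + pot (\<phi> t)) / sqrt l)) (at t)" if "t \<in> {0<..<1}" for t
      using \<phi>d that by simp
  qed (use R l m in auto)
  interpret trajectory R l m \<phi> by fact
  have rate: "(\<integral>t. (rate t)\<^sup>2 \<partial>lborel01) = A"
  proof -
    have ac: "continuous_on {1 / 2..R + 1} a"
      unfolding a_def[abs_def] by (rule continuous_on_action_integrand) auto
    define H where "H s = integral {1 / 2..s} a" for s
    have Hd: "(H has_real_derivative a s) (at s within ?I)" if "s \<in> ?I" for s
      unfolding H_def[abs_def] by (rule integral_has_real_derivative[OF ac that])
    have Hc: "continuous_on ?I H" by (rule DERIV_continuous_on[OF Hd])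
    \<comment> \<open>Change of variables s = \<phi> t, carried out through the antiderivative
      \<open>H\<close> of \<open>a\<close>: the factor \<phi> in \<phi>' cancels the denominator of
      \<open>a\<close>.\<close>
    have "(\<integral>t. sqrt l * (rate t)\<^sup>2 \<partial>lborel01) = H (\<phi> 1) - H (\<phi> 0)"
    proof (rule integral01_FTC)
      show "continuous_on {0..1} (\<lambda>t. H (\<phi> t))"
        by (rule continuous_on_compose2[OF Hc cont]) (use ge1 leR in force)
      show "integrable lborel01 (\<lambda>t. sqrt l * (rate t)\<^sup>2)"
        using L2D(2)[OF L2_continuous[OF continuous_rate]] by simp
      fix t :: real assume t: "t \<in> {0<..<1}"
      have \<phi>t: "1 \<le> \<phi> t" "\<phi> t \<le> R" using ge1[of t] leR[of t] t by auto
      have "at (\<phi> t) within ?I = at (\<phi> t)"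
        by (rule at_within_interior) (use \<phi>t R in \<open>auto simp: interior_atLeastAtMost_real\<close>)
      then have "(H has_real_derivative a (\<phi> t)) (at (\<phi> t))" using Hd[of "\<phi> t"] \<phi>t by simp
      from DERIV_chain2[OF this \<phi>_deriv[OF t]]
      have "((\<lambda>t. H (\<phi> t)) has_real_derivative a (\<phi> t) * (\<phi> t * rate t)) (at t)" .
      moreover have "a (\<phi> t) * (\<phi> t * rate t) = sqrt l * (rate t)\<^sup>2"
      proof -
        have "sqrt (m + pot (\<phi> t)) = sqrt l * rate t" using l by (simp add: rate_def)
        then show ?thesis using \<phi>t by (simp add: a_def power2_eq_square)
      qed
      ultimately show "((\<lambda>t. H (\<phi> t)) has_real_derivative sqrt l * (rate t)\<^sup>2) (at t)" by simp
    qed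
    also have "\<dots> = H R - H 1" by (simp add: \<phi>0 \<phi>1)
    also have "\<dots> = action_integral R m"
    proof -
      have "integral {1 / 2..1} a + integral {1..R} a = integral {1 / 2..R} a"
        by (rule Henstock_Kurzweil_Integration.integral_combine)
           (use R in \<open>auto intro!: integrable_continuous_real continuous_on_subset[OF ac]\<close>)
      then show ?thesis by (simp add: H_def action_integral_def a_def[abs_def])
    qed
    finally have "sqrt l * (\<integral>t. (rate t)\<^sup>2 \<partial>lborel01) = action_integral R m" by simp
    then show ?thesis using act l by (auto simp: field_simps)
  qed
  have "G A \<phi> = 0" using G_eq_rate[of A] rate by (simp add: zero_ereal_def)
  from that[OF tr this rate \<phi>d] show thesis .
qed

section \<open>Existence, and uniqueness of minimizers, critical points and multipliers\<close>

theorem theorem3p4: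
  fixes R A :: real
  assumes "R > 1" and "A > 0" and "A > (ln R)\<^sup>2"
  shows "\<exists>\<psi> lam. \<psi> \<in> C2_on {0<..<1} \<inter> Q12 R \<and> lam > 0 \<and>
      \<comment> \<open>(i), (ii)\<close>
      critical_point (\<lambda>\<phi>. ereal (J \<phi>) + ereal lam * G A \<phi>) W012 \<psi> \<and> G A \<psi> = 0 \<and>
      \<comment> \<open>uniqueness from (i), (ii)\<close>
      (\<forall>\<phi> \<in> C2_on {0<..<1} \<inter> Q12 R.
         (\<exists>l>0. critical_point (\<lambda>\<xi>. ereal (J \<xi>) + ereal l * G A \<xi>) W012 \<phi> \<and> G A \<phi> = 0)
         \<longrightarrow> (\<forall>t\<in>{0..1}. \<phi> t = \<psi> t)) \<and>
      \<comment> \<open>(iii)\<close>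
      strict_mono_on {0..1} \<psi> \<and>
      (\<exists>\<mu>>0. multiplier_system R A lam \<mu> \<and>
         (\<forall>l>0. \<forall>m>0. multiplier_system R A l m \<longrightarrow> l = lam \<and> m = \<mu>) \<and>
         \<psi> 0 = 1 \<and>
         (\<forall>t\<in>{0..1}. (\<psi> has_real_derivative
            1 / sqrt lam * \<psi> t * sqrt (\<mu> + ((\<psi> t)\<^sup>2 - 1)\<^sup>2 + (\<psi> t - 1)\<^sup>2)) (at t within {0..1}))) \<and>
      \<comment> \<open>(iv)\<close>
      is_arg_min J (\<lambda>\<phi>. \<phi> \<in> Q_plus R \<and> G A \<phi> \<le> 0) \<psi> \<and>
      (\<forall>\<phi>. is_arg_min J (\<lambda>\<xi>. \<xi> \<in> Q_plus R \<and> G A \<xi> \<le> 0) \<phi> \<longrightarrow> (\<forall>t\<in>{0..1}. \<phi> t = \<psi> t))"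
proof -
  note R = assms(1)
  obtain lam \<mu> where pos: "lam > 0" "\<mu> > 0" and sys: "multiplier_system R A lam \<mu>"
    by (rule multiplier_system_solvable[OF R assms(3)])
  obtain \<psi> where tr: "trajectory R lam \<mu> \<psi>" and G: "G A \<psi> = 0"
    and rate: "(\<integral>t. (trajectory.rate lam \<mu> \<psi> t)\<^sup>2 \<partial>lborel01) = A"
    and der: "\<And>t. t \<in> {0..1} \<Longrightarrow> (\<psi> has_real_derivative \<psi> t * (sqrt (\<mu> + pot (\<psi> t)) / sqrt lam)) (at t)"
    using multiplier_system_trajectory[OF R pos sys] by blast
  interpret \<psi>: trajectory R lam \<mu> \<psi> by fact
  \<comment> \<open>Minimality is used twice, once around each function: that of \<phi> gives
    \<open>J \<phi> \<le> J \<psi>\<close>, and then the equality case around \<psi> applies. The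
    constants l and m may differ from those of \<psi>.\<close>
  have same: "\<phi> t = \<psi> t" if \<phi>: "trajectory R l m \<phi>" "G A \<phi> = 0" and t: "t \<in> {0..1}" for \<phi> l m t
  proof -
    interpret \<phi>: trajectory R l m \<phi> by fact
    have "(\<integral>t. (\<phi>.rate t)\<^sup>2 \<partial>lborel01) = A"
      using \<phi>.G_eq_rate[of A] \<phi>(2) by (simp add: zero_ereal_def)
    then have "J \<phi> \<le> J \<psi>" by (rule \<phi>.minimal(1)[OF _ \<psi>.in_Q_plus]) (simp add: G)
    with \<phi>(2) show ?thesis by (intro \<psi>.minimal(2)[OF rate \<phi>.in_Q_plus _ _ t]) auto
  qed
  have unique: "\<forall>t\<in>{0..1}. \<phi> t = \<psi> t"
    if crit: "\<phi> \<in> C2_on {0<..<1} \<inter> Q12 R" "l > 0"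
      "critical_point (\<lambda>\<xi>. ereal (J \<xi>) + ereal l * G A \<xi>) W012 \<phi>" "G A \<phi> = 0" for \<phi> l
  proof -
    obtain m where "trajectory R l m \<phi>"
      by (rule critical_imp_trajectory[OF R crit(2) _ _ crit(3,4)]) (use crit(1) in auto)
    then show ?thesis using same crit(4) by blast
  qed
  have unique_multipliers: "l = lam \<and> m = \<mu>" if lm: "l > 0" "m > 0" "multiplier_system R A l m" for l m
  proof -
    obtain \<phi> where \<phi>: "trajectory R l m \<phi>" "G A \<phi> = 0"
      and d: "\<And>t. t \<in> {0..1} \<Longrightarrow> (\<phi> has_real_derivative \<phi> t * (sqrt (m + pot (\<phi> t)) / sqrt l)) (at t)"
      using multiplier_system_trajectory[OF R lm] by blast
    interpret \<phi>: trajectory R l m \<phi> by fact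
    \<comment> \<open>\<phi> and \<psi> are known to agree only on [0,1], so their slopes are
      compared through derivatives within the closed interval, which are one-sided at the
      ends.\<close>
    have eq: "(m + pot (\<psi> t)) / l = (\<mu> + pot (\<psi> t)) / lam" if t: "t \<in> {0..1}" for t
    proof -
      have "(\<psi> has_real_derivative \<phi> t * (sqrt (m + pot (\<phi> t)) / sqrt l)) (at t within {0..1})"
        by (rule has_field_derivative_transform_within[OF has_field_derivative_at_within[OF d[OF t]], of 1])
           (use t same[OF \<phi>] in auto)
      moreover have "(\<psi> has_real_derivative \<psi> t * (sqrt (\<mu> + pot (\<psi> t)) / sqrt lam)) (at t within {0..1})"
        by (rule has_field_derivative_at_within[OF der[OF t]])
      ultimately have "\<phi> t * (sqrt (m + pot (\<phi> t)) / sqrt l) = \<psi> t * (sqrt (\<mu> + pot (\<psi> t)) / sqrt lam)"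
        using t by (intro vector_derivative_unique_within_closed_interval[of 0 1 t])
          (auto simp: has_real_derivative_iff_has_vector_derivative)
      then have "\<psi> t * \<phi>.rate t = \<psi> t * \<psi>.rate t"
        unfolding \<phi>.rate_def \<psi>.rate_def same[OF \<phi> t] .
      then have "\<phi>.rate t = \<psi>.rate t" using \<psi>.pos[OF t] by simp
      then show ?thesis using \<phi>.rate_square[of t] \<psi>.rate_square[of t] same[OF \<phi> t] by simp
    qed
    \<comment> \<open>At t = 0 the potential vanishes, which leaves the ratio of the multipliers; at
      t = 1 the term \<open>pot R > 0\<close> then isolates l.\<close>
    have 0: "m / l = \<mu> / lam" using eq[of 0] \<psi>.\<phi>0 by (simp add: pot_def)
    have "(m + pot R) / l = (\<mu> + pot R) / lam" using eq[of 1] \<psi>.\<phi>1 by simp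
    then have "pot R / l = pot R / lam" using 0 by (simp add: add_divide_distrib)
    moreover have "pot R > 0" using R by (simp add: pot_def add_nonneg_pos)
    ultimately have "l = lam" using lm pos by (simp add: field_simps)
    with 0 pos show ?thesis by simp
  qed
  have arg_min: "is_arg_min J (\<lambda>\<phi>. \<phi> \<in> Q_plus R \<and> G A \<phi> \<le> 0) \<psi>"
    using \<psi>.in_Q_plus G \<psi>.minimal(1)[OF rate] by (simp add: is_arg_min_linorder)
  have unique_arg_min: "\<forall>t\<in>{0..1}. \<phi> t = \<psi> t"
    if "is_arg_min J (\<lambda>\<xi>. \<xi> \<in> Q_plus R \<and> G A \<xi> \<le> 0) \<phi>" for \<phi>
  proof
    fix t :: real assume t: "t \<in> {0..1}"
    have "\<phi> \<in> Q_plus R" "G A \<phi> \<le> 0" "J \<phi> \<le> J \<psi>"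
      using that \<psi>.in_Q_plus G by (auto simp: is_arg_min_linorder)
    then show "\<phi> t = \<psi> t" by (rule \<psi>.minimal(2)[OF rate _ _ _ t])
  qed
  have ode: "(\<psi> has_real_derivative
      1 / sqrt lam * \<psi> t * sqrt (\<mu> + ((\<psi> t)\<^sup>2 - 1)\<^sup>2 + (\<psi> t - 1)\<^sup>2)) (at t within {0..1})" if "t \<in> {0..1}" for t
    using has_field_derivative_at_within[OF der[OF that], of "{0..1}"] by (simp add: pot_def add.assoc)
  show ?thesis
  proof (rule exI[of _ \<psi>], rule exI[of _ lam], intro conjI)
    show "\<psi> \<in> C2_on {0<..<1} \<inter> Q12 R" using \<psi>.C2 \<psi>.in_Q12 by (rule IntI)
    show "critical_point (\<lambda>\<phi>. ereal (J \<phi>) + ereal lam * G A \<phi>) W012 \<psi>" by (rule \<psi>.critical)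
    show "\<forall>\<phi> \<in> C2_on {0<..<1} \<inter> Q12 R.
         (\<exists>l>0. critical_point (\<lambda>\<xi>. ereal (J \<xi>) + ereal l * G A \<xi>) W012 \<phi> \<and> G A \<phi> = 0)
         \<longrightarrow> (\<forall>t\<in>{0..1}. \<phi> t = \<psi> t)"
    proof (intro ballI[of "C2_on {0<..<1} \<inter> Q12 R"] impI, elim exE conjE)
      fix \<phi> l
      assume "\<phi> \<in> C2_on {0<..<1} \<inter> Q12 R" "0 < l"
        "critical_point (\<lambda>\<xi>. ereal (J \<xi>) + ereal l * G A \<xi>) W012 \<phi>" "G A \<phi> = 0"
      then show "\<forall>t\<in>{0..1}. \<phi> t = \<psi> t" by (rule unique)
    qed
    show "\<exists>\<mu>>0. multiplier_system R A lam \<mu> \<and>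
         (\<forall>l>0. \<forall>m>0. multiplier_system R A l m \<longrightarrow> l = lam \<and> m = \<mu>) \<and>
         \<psi> 0 = 1 \<and>
         (\<forall>t\<in>{0..1}. (\<psi> has_real_derivative
            1 / sqrt lam * \<psi> t * sqrt (\<mu> + ((\<psi> t)\<^sup>2 - 1)\<^sup>2 + (\<psi> t - 1)\<^sup>2)) (at t within {0..1}))"
      by (rule exI[of _ \<mu>], intro conjI allI impI ballI pos sys unique_multipliers \<psi>.\<phi>0 ode)
    show "\<forall>\<phi>. is_arg_min J (\<lambda>\<xi>. \<xi> \<in> Q_plus R \<and> G A \<xi> \<le> 0) \<phi> \<longrightarrow> (\<forall>t\<in>{0..1}. \<phi> t = \<psi> t)"
      by (intro allI impI unique_arg_min)
  qed (fact pos(1) G \<psi>.strict_mono arg_min)+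
qed

end
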